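(* There is a discrete gradient vector field on $\mathrm{ucel}(n,w)$ such that the critical cells are in bijection with a basis for $H_*(\mathrm{ucel}(n,w);\mathbb Q)$. The critical cells are described as follows: - For $w=2$, every cell. - For $w=3$, the concatenation of zero or more blocks $\circ^2$, followed by zero or more singletons $\circ^1$. - For $w>2$ even, the concatenation of zero or more copies of $\circ^2\mid\circ^w$ or strings ending in $\circ^1\mid\circ^w$, followed by the concatenation of zero or more singletons $\circ^1$. For each string ending in $\circ^1\mid\circ^w$, it consists of an optional $\circ^2$, followed by zero or more singletons $\circ^1$, followed by the pair $\circ^1\mid\circ^w$. - For $w>3$ odd, the concatenation of zero or more pairs $\circ^2\mid\circ^{w-1}$, followed by an optional $\circ^2$, followed by zero or more singletons $\circ^1$.
   Context: A symbol on $\{1,\dots,n\}$ is a sequence of nonempty blocks $b_1\mid\cdots\mid b_m$, each block an ordered list, each label occurring exactly once. $\mathrm{cel}(n,w)$ is the cell complex with one $(n-m)$-cell for each symbol whose blocks have at most $w$ elements; codimension-one faces are obtained by replacing a block by two consecutive blocks $a\mid b$ of which it is a shuffle. The boundary of a one-block symbol $g$ has $a\mid b$ with coefficient $(-1)^{\mathrm{length}(a)}$ times the sign of the permutation taking the list $g$ to $ab$, and $\partial(g_1\mid g_2)=\partial g_1\mid g_2+(-1)^{\dim g_1}g_1\mid\partial g_2$. $S_n$ acts freely and cellularly by relabeling, preserving cell orientations, and $\mathrm{ucel}(n,w)=\mathrm{cel}(n,w)/S_n$; it is homotopy equivalent to the configuration space of $n$ unlabeled non-overlapping disks of diameter $1$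 in a strip of width $w$. A cell of $\mathrm{ucel}(n,w)$ is determined by its sequence of block sizes (weights) and is written $\circ^{k_1}\mid\circ^{k_2}\mid\cdots\mid\circ^{k_m}$ with $k_1+\dots+k_m=n$, $1\le k_i\le w$; its dimension is $n-m$. Concatenation means placing symbols next to each other with a bar in between. A discrete vector field (with coefficients in $\mathbb Q$) is a set $V$ of pairs $[f,g]$ of cells with $\dim g=\dim f+1$, such that $f$ has nonzero coefficient in $\partial g$ and each cell is in at most one pair. It is gradient if there is no closed $V$-walk, i.e. no sequence $[f_1,g_1],\dots,[f_r,g_r]$ of pairs in $V$ with $r\ge 2$, each $f_{i+1}$ a face of $g_i$ (with nonzero coefficient) other than $f_i$, and $f_r=f_1$. A cell is critical if it is in no pair of $V$.
   Formalization: Corrected for even w>2: an optional ∘² is allowed just before the final singletons ∘¹. As printed the list fails for every n≥2; e.g. for n=2, w=4 the cell ∘² has zero boundary in ucel, so it must be critical, but it is not listed. *)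

theory Defs
  imports
    "HOL-Combinatorics.Permutations"
    "Jordan_Normal_Form.VS_Connect"
begin

section \<open>The complex cel(n,w)\<close>

type_synonym symb = "nat list list"

text \<open>All lengths of blocks are at most \<^term>\<open>w\<close>; every label in
  \<^term>\<open>{1..n}\<close> occurs exactly once.\<close>

definition cel :: "nat \<Rightarrow> nat \<Rightarrow> symb set" where
  "cel n w = {s. (\<forall>b\<in>set s. b \<noteq> [] \<and> length b \<le> w)
                 \<and> distinct (concat s) \<and> set (concat s) = {1..n}}"

definition cel_dim :: "symb \<Rightarrow> nat" where
  "cel_dim s = length (concat s) - length s"

text \<open>The coefficient of the two-block symbol \<^term>\<open>[a, b]\<close> in the boundary of the
  one-block symbol \<^term>\<open>[g]\<close>.\<close>

definition block_incidence :: "nat list \<Rightarrow> nat list \<Rightarrow> nat list \<Rightarrow> int" where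
  "block_incidence g a b =
     (if a \<noteq> [] \<and> b \<noteq> [] \<and> g \<in> shuffles a b
      then (- 1) ^ length a * sign (THE p. p permutes set g \<and> map p g = a @ b)
      else 0)"

text \<open>\<^term>\<open>cel_incidence s f\<close> is the coefficient of \<^term>\<open>f\<close> in the boundary of
  \<^term>\<open>s\<close>. The recursion is the Leibniz rule, splitting off the first block
  \<^term>\<open>g\<close>, whose dimension is \<^term>\<open>length g - 1\<close>: the first summand collects the
  terms of the boundary of \<^term>\<open>g\<close> followed by \<^term>\<open>s\<close>, the second one those of
  \<^term>\<open>g\<close> followed by the boundary of \<^term>\<open>s\<close>.\<close>

fun cel_incidence :: "symb \<Rightarrow> symb \<Rightarrow> int" where
  "cel_incidence [] f = 0"
| "cel_incidence (g # s) f =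
     (case f of a # b # t \<Rightarrow> if t = s then block_incidence g a b else 0 | _ \<Rightarrow> 0)
   + (case f of h # t \<Rightarrow> if h = g then (- 1) ^ (length g - 1) * cel_incidence s t else 0
              | _ \<Rightarrow> 0)"

section \<open>The quotient complex ucel(n,w)\<close>

text \<open>A cell of the quotient is an orbit of symbols under relabelling.\<close>

type_synonym ucell = "symb set"

definition relabel :: "(nat \<Rightarrow> nat) \<Rightarrow> symb \<Rightarrow> symb" where
  "relabel p s = map (map p) s"

definition symb_orbit :: "nat \<Rightarrow> symb \<Rightarrow> ucell" where
  "symb_orbit n s = {relabel p s | p. p permutes {1..n}}"

definition ucel :: "nat \<Rightarrow> nat \<Rightarrow> ucell set" where
  "ucel n w = symb_orbit n ` cel n w"

definition ucel_cells :: "nat \<Rightarrow> nat \<Rightarrow> nat \<Rightarrow> ucell set" where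
  "ucel_cells n w k = symb_orbit n ` {s \<in> cel n w. cel_dim s = k}"

text \<open>\<^term>\<open>ucel_incidence G F\<close> is the coefficient of \<^term>\<open>F\<close> in the boundary of
  \<^term>\<open>G\<close>: take the boundary of any representative of \<^term>\<open>G\<close> and project it to
  the quotient. Relabelling preserves \<^const>\<open>cel_incidence\<close>, so the representative
  does not matter.\<close>

definition ucel_incidence :: "ucell \<Rightarrow> ucell \<Rightarrow> int" where
  "ucel_incidence G F = (\<Sum>f\<in>F. cel_incidence (SOME g. g \<in> G) f)"

section \<open>Cellular homology of ucel(n,w) with rational coefficients\<close>

type_synonym uchain = "ucell \<Rightarrow> rat"

definition ucel_chains :: "nat \<Rightarrow> nat \<Rightarrow> nat \<Rightarrow> uchain set" where
  "ucel_chains n w k = {c. \<forall>F. F \<notin> ucel_cells n w k \<longrightarrow> c F = 0}"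

definition ucel_bd :: "nat \<Rightarrow> nat \<Rightarrow> uchain \<Rightarrow> uchain" where
  "ucel_bd n w c = (\<lambda>F. if F \<in> ucel n w
     then \<Sum>G\<in>ucel n w. c G * of_int (ucel_incidence G F) else 0)"

definition ucel_cycles :: "nat \<Rightarrow> nat \<Rightarrow> nat \<Rightarrow> uchain set" where
  "ucel_cycles n w k = {c \<in> ucel_chains n w k. ucel_bd n w c = (\<lambda>_. 0)}"

definition ucel_boundaries :: "nat \<Rightarrow> nat \<Rightarrow> nat \<Rightarrow> uchain set" where
  "ucel_boundaries n w k = ucel_bd n w ` ucel_chains n w (Suc k)"

definition homology_class :: "nat \<Rightarrow> nat \<Rightarrow> nat \<Rightarrow> uchain \<Rightarrow> uchain set" where
  "homology_class n w k z = {\<lambda>F. z F + b F | b. b \<in> ucel_boundaries n w k}"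

text \<open>The degree \<^term>\<open>k\<close> homology is the quotient of cycles by boundaries, as a vector
  space over the field \<^term>\<open>class_ring :: rat ring\<close>. Its elements are cosets. The
  boundaries added in the scalar multiplication only matter for the scalar 0. The ring
  multiplication fields of the record are irrelevant for modules.\<close>

definition ucel_homology :: "nat \<Rightarrow> nat \<Rightarrow> nat \<Rightarrow> (rat, uchain set) module" where
  "ucel_homology n w k =
     \<lparr>carrier = homology_class n w k ` ucel_cycles n w k,
      mult = undefined, one = undefined,
      zero = ucel_boundaries n w k,
      add = (\<lambda>X Y. {\<lambda>F. x F + y F | x y. x \<in> X \<and> y \<in> Y}),
      smult = (\<lambda>c X. {\<lambda>F. c * x F + b F | x b. x \<in> X \<and> b \<in> ucel_boundaries n w k})\<rparr>"

lemma ucel_bd_add: "ucel_bd n w (\<lambda>F. x F + y F) = (\<lambda>F. ucel_bd n w x F + ucel_bd n w y F)"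
  by (auto simp: ucel_bd_def fun_eq_iff distrib_right sum.distrib)

lemma ucel_bd_scale: "ucel_bd n w (\<lambda>F. c * x F) = (\<lambda>F. c * ucel_bd n w x F)"
  by (auto simp: ucel_bd_def fun_eq_iff sum_distrib_left mult.assoc)

lemma ucel_bd_zero: "ucel_bd n w (\<lambda>F. 0) = (\<lambda>F. 0)"
  by (auto simp: ucel_bd_def fun_eq_iff)

lemma ucel_boundaries_add:
  "x \<in> ucel_boundaries n w k \<Longrightarrow> y \<in> ucel_boundaries n w k
    \<Longrightarrow> (\<lambda>F. x F + y F) \<in> ucel_boundaries n w k"
  by (force simp: ucel_boundaries_def ucel_chains_def simp flip: ucel_bd_add)

lemma ucel_boundaries_scale:
  "x \<in> ucel_boundaries n w k \<Longrightarrow> (\<lambda>F. c * x F) \<in> ucel_boundaries n w k"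
  by (force simp: ucel_boundaries_def ucel_chains_def simp flip: ucel_bd_scale)

lemma ucel_boundaries_zero: "(\<lambda>F. 0) \<in> ucel_boundaries n w k"
  unfolding ucel_boundaries_def
  by (rule image_eqI[of _ _ "\<lambda>F. 0"]) (auto simp: ucel_chains_def ucel_bd_zero)

lemma ucel_cycles_add:
  "x \<in> ucel_cycles n w k \<Longrightarrow> y \<in> ucel_cycles n w k \<Longrightarrow> (\<lambda>F. x F + y F) \<in> ucel_cycles n w k"
  by (auto simp: ucel_cycles_def ucel_chains_def ucel_bd_add)

lemma ucel_cycles_scale:
  "x \<in> ucel_cycles n w k \<Longrightarrow> (\<lambda>F. c * x F) \<in> ucel_cycles n w k"
  by (auto simp: ucel_cycles_def ucel_chains_def ucel_bd_scale)

lemma ucel_cycles_zero: "(\<lambda>F. 0) \<in> ucel_cycles n w k"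
  by (auto simp: ucel_cycles_def ucel_chains_def ucel_bd_zero)

lemma homology_classI:
  "b \<in> ucel_boundaries n w k \<Longrightarrow> (\<lambda>F. z F + b F) \<in> homology_class n w k z"
  by (auto simp: homology_class_def)

lemma homology_class_zero: "homology_class n w k (\<lambda>F. 0) = ucel_boundaries n w k"
  by (auto simp: homology_class_def)

lemma homology_class_add:
  "{\<lambda>F. x F + y F | x y. x \<in> homology_class n w k u \<and> y \<in> homology_class n w k v}
     = homology_class n w k (\<lambda>F. u F + v F)" (is "?L = ?R")
proof
  show "?L \<subseteq> ?R"
  proof
    fix x assume "x \<in> ?L"
    then obtain b c where bc: "b \<in> ucel_boundaries n w k" "c \<in> ucel_boundaries n w k"
      and x: "x = (\<lambda>F. u F + b F + (v F + c F))"
      by (auto simp: homology_class_def)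
    have "x = (\<lambda>F. (u F + v F) + (b F + c F))"
      by (simp add: x fun_eq_iff)
    then show "x \<in> ?R"
      using homology_classI[OF ucel_boundaries_add[OF bc]] by simp
  qed
  show "?R \<subseteq> ?L"
  proof
    fix x assume "x \<in> ?R"
    then obtain b where b: "b \<in> ucel_boundaries n w k" and x: "x = (\<lambda>F. u F + v F + b F)"
      by (auto simp: homology_class_def)
    have "x = (\<lambda>F. (u F + b F) + (v F + 0))"
      by (simp add: x fun_eq_iff)
    moreover have "(\<lambda>F. u F + b F) \<in> homology_class n w k u"
      using b by (auto simp: homology_class_def)
    moreover have "(\<lambda>F. v F + 0) \<in> homology_class n w k v"
      by (rule homology_classI[OF ucel_boundaries_zero])
    ultimately show "x \<in> ?L"
      by (intro CollectI exI[of _ "\<lambda>F. u F + b F"] exI[of _ "\<lambda>F. v F + 0"] conjI)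
  qed
qed

lemma homology_class_scale:
  "{\<lambda>F. c * x F + b F | x b. x \<in> homology_class n w k u \<and> b \<in> ucel_boundaries n w k}
     = homology_class n w k (\<lambda>F. c * u F)" (is "?L = ?R")
proof
  show "?L \<subseteq> ?R"
  proof
    fix x assume "x \<in> ?L"
    then obtain b d where bd: "b \<in> ucel_boundaries n w k" "d \<in> ucel_boundaries n w k"
      and x: "x = (\<lambda>F. c * (u F + d F) + b F)"
      by (auto simp: homology_class_def)
    have "x = (\<lambda>F. c * u F + (c * d F + b F))"
      by (simp add: x fun_eq_iff algebra_simps)
    then show "x \<in> ?R"
      using homology_classI[OF ucel_boundaries_add[OF ucel_boundaries_scale[OF bd(2)] bd(1)]]
      by simp
  qed
  show "?R \<subseteq> ?L"
  proof
    fix x assume "x \<in> ?R"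
    then obtain b where b: "b \<in> ucel_boundaries n w k" and x: "x = (\<lambda>F. c * u F + b F)"
      by (auto simp: homology_class_def)
    have "x = (\<lambda>F. c * (u F + 0) + b F)"
      by (simp add: x)
    moreover have "(\<lambda>F. u F + 0) \<in> homology_class n w k u"
      by (rule homology_classI[OF ucel_boundaries_zero])
    ultimately show "x \<in> ?L" using b
      by (intro CollectI exI[of _ "\<lambda>F. u F + 0"] exI[of _ b] conjI)
  qed
qed

lemma vectorspace_ucel_homology:
  "vectorspace (class_ring :: rat ring) (ucel_homology n w k)"
proof -
  let ?K = "class_ring :: rat ring"
  let ?H = "ucel_homology n w k"
  have car: "carrier ?H = homology_class n w k ` ucel_cycles n w k"
    and zer: "\<zero>\<^bsub>?H\<^esub> = homology_class n w k (\<lambda>F. 0)"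
    by (simp_all add: ucel_homology_def homology_class_zero)
  have add: "homology_class n w k u \<oplus>\<^bsub>?H\<^esub> homology_class n w k v
               = homology_class n w k (\<lambda>F. u F + v F)" for u v
    by (simp add: ucel_homology_def homology_class_add)
  have scale: "c \<odot>\<^bsub>?H\<^esub> homology_class n w k u = homology_class n w k (\<lambda>F. c * u F)" for c u
    by (simp add: ucel_homology_def homology_class_scale)
  have inv: "\<exists>y\<in>ucel_cycles n w k. homology_class n w k (\<lambda>F. x F + y F) = homology_class n w k (\<lambda>F. 0)"
    if "x \<in> ucel_cycles n w k" for x
    using ucel_cycles_scale[OF that, of "-1"] by (intro bexI[of _ "\<lambda>F. -1 * x F"]) auto
  have ab: "abelian_group ?H"
    by (rule abelian_groupI)
      (auto simp: car zer add ucel_cycles_add ucel_cycles_zero inv ac_simps)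
  have "Module.module ?K ?H"
    by (rule Module.moduleI[OF class_cring.is_cring ab])
      (auto simp: car add scale ucel_cycles_scale algebra_simps)
  then show ?thesis
    using class_field.field_axioms by (simp add: vectorspace_def)
qed

section \<open>Discrete gradient vector fields\<close>

definition discrete_vector_field :: "nat \<Rightarrow> nat \<Rightarrow> (ucell \<times> ucell) set \<Rightarrow> bool" where
  "discrete_vector_field n w V \<longleftrightarrow>
     (\<forall>(F, G)\<in>V. (\<exists>k. F \<in> ucel_cells n w k \<and> G \<in> ucel_cells n w (Suc k))
                  \<and> ucel_incidence G F \<noteq> 0)
   \<and> (\<forall>p\<in>V. \<forall>q\<in>V. p \<noteq> q \<longrightarrow> {fst p, snd p} \<inter> {fst q, snd q} = {})"

definition closed_walk :: "(ucell \<times> ucell) set \<Rightarrow> (ucell \<times> ucell) list \<Rightarrow> bool" where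
  "closed_walk V ps \<longleftrightarrow> length ps \<ge> 2 \<and> set ps \<subseteq> V
     \<and> (\<forall>i. Suc i < length ps \<longrightarrow>
           ucel_incidence (snd (ps ! i)) (fst (ps ! Suc i)) \<noteq> 0
         \<and> fst (ps ! Suc i) \<noteq> fst (ps ! i))
     \<and> fst (last ps) = fst (hd ps)"

definition discrete_gradient_vector_field :: "nat \<Rightarrow> nat \<Rightarrow> (ucell \<times> ucell) set \<Rightarrow> bool" where
  "discrete_gradient_vector_field n w V \<longleftrightarrow>
     discrete_vector_field n w V \<and> (\<nexists>ps. closed_walk V ps)"

definition critical_cells :: "nat \<Rightarrow> nat \<Rightarrow> (ucell \<times> ucell) set \<Rightarrow> ucell set" where
  "critical_cells n w V = {G \<in> ucel n w. \<forall>p\<in>V. G \<noteq> fst p \<and> G \<noteq> snd p}"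

section \<open>The sequences of weights of the critical cells\<close>

definition optional_two :: "nat list set" where
  "optional_two = {[], [2]}"

definition singletons :: "nat list set" where
  "singletons = {replicate j 1 | j. True}"

definition even_pieces :: "nat \<Rightarrow> nat list set" where
  "even_pieces w = {[2, w]} \<union> {e @ u @ [1, w] | e u. e \<in> optional_two \<and> u \<in> singletons}"

text \<open>For even \<^term>\<open>w\<close> the trailing singletons may be preceded by one block of weight 2,
  as in the odd case. This cannot be omitted: in ucel(2,w) with \<^prop>\<open>w \<ge> 2\<close> the
  boundary of the 1-cell of weights \<^term>\<open>[2::nat]\<close> is zero, so it is critical for every
  discrete vector field (and there is a nonzero class in degree 1).\<close>

definition critical_weights :: "nat \<Rightarrow> nat list set" where
  "critical_weights w =
     (if w = 2 then UNIV
      else if w = 3 then {replicate i 2 @ u | i u. u \<in> singletons}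
      else if even w then
        {concat bs @ e @ u | bs e u.
           set bs \<subseteq> even_pieces w \<and> e \<in> optional_two \<and> u \<in> singletons}
      else
        {concat (replicate i [2, w - 1]) @ e @ u | i e u.
           e \<in> optional_two \<and> u \<in> singletons})"

end

theory Submission
  imports Defs
begin

text \<open>
  A cell of the quotient is a word of weights, and a block \<open>k\<close> splits into \<open>i | k - i\<close> with
  coefficient a sign times the Gaussian binomial coefficient at \<open>q = -1\<close>, which vanishes for
  \<open>i\<close> and \<open>k - i\<close> odd and is an ordinary binomial coefficient otherwise. The matching
  reads a word from the left: at the first possible place it merges \<open>j | k\<close> with \<open>j \<le> 2\<close> and
  \<open>k\<close> even into one block, or splits 1 (if \<open>k\<close> is odd) or 2 off a block \<open>k > 2\<close>. The words
  where this is impossible consist of blocks \<open>1\<close> and \<open>2\<close>, and of pairs \<open>j | k\<close> with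
  \<open>j \<le> 2\<close> and \<open>k\<close> even that cannot be merged only because \<open>j + k\<close> exceeds \<open>w\<close>.

  In a suitable lexicographic order the lower cell of a pair is the leading term of the boundary of
  the upper cell, so the matching is acyclic. A critical word is the leading term of a cycle: replace
  each pair \<open>j | k\<close> by what would be the boundary of a block \<open>j + k\<close>. These cycles, the
  boundaries of the upper cells and the upper cells themselves form a triangular basis of the chains,
  from which the homology can be read off; no differential of the Morse complex has to be computed.
\<close>

section \<open>Boundaries and cycles of words\<close>

text \<open>The Gaussian binomial coefficient of \<open>i + j\<close> over \<open>i\<close> at \<open>q = -1\<close>.\<close>

definition qbin :: "nat \<Rightarrow> nat \<Rightarrow> int" where
  "qbin i j = (if odd i \<and> odd j then 0 else int ((i div 2 + j div 2) choose (i div 2)))"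

lemma qbin_0 [simp]: "qbin 0 j = 1" "qbin i 0 = 1"
  by (auto simp: qbin_def)

text \<open>The q-Pascal rule at \<open>q = -1\<close>. The same recursion governs
  \<open>sum_splits\<close>, where the first label of a block goes to one of the two parts.\<close>

lemma qbin_Suc_Suc:
  "qbin (Suc i) (Suc j) = qbin i (Suc j) + (- 1) ^ Suc i * qbin (Suc i) j"
proof -
  consider m l where "i = 2 * m" "j = 2 * l" | m l where "i = 2 * m + 1" "j = 2 * l"
    | m l where "i = 2 * m" "j = 2 * l + 1" | m l where "i = 2 * m + 1" "j = 2 * l + 1"
    by (metis oddE evenE)
  then show ?thesis
    by cases (simp_all add: qbin_def)
qed

text \<open>Both sides are the Gaussian trinomial coefficient at \<open>q = -1\<close>: it vanishes
  if two of the three numbers are odd and is otherwise the ordinary trinomial coefficient of the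
  halves, rounded down.\<close>

lemma qbin_assoc: "qbin (i + j) l * qbin i j = qbin i (j + l) * qbin j l"
proof (cases "(odd i \<and> odd j) \<or> (odd i \<and> odd l) \<or> (odd j \<and> odd l)")
  case True
  then show ?thesis
    by (auto simp: qbin_def)
next
  case False
  define a b c where "a = i div 2" and "b = j div 2" and "c = l div 2"
  have div: "(i + j) div 2 = a + b" "(j + l) div 2 = b + c"
    using False unfolding a_def b_def c_def by presburger+
  have "(a + b + c choose (a + b)) * (a + b choose a) = (a + b + c choose a) * (b + c choose b)"
    using choose_mult[of a "a + b" "a + b + c"] by (simp add: algebra_simps)
  then have "int (a + b + c choose (a + b)) * int (a + b choose a)
      = int (a + b + c choose a) * int (b + c choose b)"
    by (metis of_nat_mult)
  then show ?thesis
    using False by (auto simp: qbin_def div a_def[symmetric] b_def[symmetric] c_def[symmetric]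
      add.assoc)
qed

text \<open>For positive \<open>i\<close> and \<open>j\<close> this is the coefficient of
  \<open>i | j\<close> in the boundary of a block of weight \<open>i + j\<close>, as
  \<open>sum_block_incidence\<close> confirms.\<close>

definition split_coeff :: "nat \<Rightarrow> nat \<Rightarrow> rat" where
  "split_coeff i j = of_int ((- 1) ^ i * qbin i j)"

lemma split_coeff_odd_odd: "odd i \<Longrightarrow> odd j \<Longrightarrow> split_coeff i j = 0"
  by (simp add: split_coeff_def qbin_def)

lemma split_coeff_nonzero: "even j \<Longrightarrow> split_coeff i j \<noteq> 0"
  by (simp add: split_coeff_def qbin_def)

text \<open>The local form of the vanishing of the squared boundary: \<open>i | j | l\<close> arises
  by cutting off \<open>l\<close> first or \<open>i\<close> first, and the Leibniz sign makes the
  two contributions cancel. For \<open>i = 0\<close> the truncated exponent would give the wrong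
  sign.\<close>

lemma split_coeff_assoc:
  assumes "i > 0"
  shows "split_coeff (i + j) l * split_coeff i j + (- 1) ^ (i - 1) * split_coeff i (j
      + l) * split_coeff j l = 0"
proof -
  have s: "(- 1 :: rat) ^ (i - Suc 0) = - ((- 1) ^ i)"
    using assms by (cases i) auto
  have "split_coeff (i + j) l * split_coeff i j = (- 1) ^ j * of_int (qbin (i + j) l * qbin i j)"
    by (simp add: split_coeff_def power_add)
  moreover have "(- 1) ^ (i - 1) * split_coeff i (j + l) * split_coeff j l
      = - ((- 1) ^ j * of_int (qbin i (j + l) * qbin j l))"
    by (cases "even i") (simp_all add: split_coeff_def s)
  ultimately show ?thesis
    by (simp only: qbin_assoc)
qed

text \<open>Chains of words enter only through linear functionals: \<open>bd_eval \<phi> g\<close> is the value of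
  \<open>\<phi>\<close> on the boundary of the word \<open>g\<close>, and \<open>cycle_eval \<phi> g\<close> its value on the
  cycle with leading term \<open>g\<close>, in which each pair \<open>j # k\<close> with \<open>k\<close> even has been replaced by
  the boundary of \<open>j + k\<close>.\<close>

fun bd_eval :: "(nat list \<Rightarrow> rat) \<Rightarrow> nat list \<Rightarrow> rat" where
  "bd_eval \<phi> [] = 0"
| "bd_eval \<phi> (k # t) = (\<Sum>i = 1..<k. split_coeff i (k - i) * \<phi> (i # (k - i) # t))
     + (- 1) ^ (k - 1) * bd_eval (\<lambda>u. \<phi> (k # u)) t"

fun cycle_eval :: "(nat list \<Rightarrow> rat) \<Rightarrow> nat list \<Rightarrow> rat" where
  "cycle_eval \<phi> [] = \<phi> []"
| "cycle_eval \<phi> [j] = \<phi> [j]"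
| "cycle_eval \<phi> (j # k # t) =
     (if even k then \<Sum>i = 1..<j + k. split_coeff i (j + k - i) * cycle_eval (\<lambda>u. \<phi> (i # (j + k
         - i) # u)) t
      else cycle_eval (\<lambda>u. \<phi> (j # u)) (k # t))"

text \<open>\<open>tgt w f\<close> is the upper cell paired with \<open>f\<close>, and \<open>src w g\<close> the lower cell paired with \<open>g\<close>.\<close>

fun tgt :: "nat \<Rightarrow> nat list \<Rightarrow> nat list option" where
  "tgt w [] = None"
| "tgt w [j] = None"
| "tgt w (j # k # t) =
     (if j = 1 \<or> j = 2 then
        if even k then if j + k \<le> w then Some ((j
            + k) # t) else map_option (\<lambda>u. j # k # u) (tgt w t)
        else map_option (\<lambda>u. j # u) (tgt w (k # t))
      else None)"

fun src :: "nat \<Rightarrow> nat list \<Rightarrow> nat list option" where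
  "src w [] = None"
| "src w [j] = (if j \<le> 2 then None else if odd j then Some [1, j - 1] else Some [2, j - 2])"
| "src w (j # k # t) =
     (if j \<le> 2 then
        if even k then if j + k \<le> w then None else map_option (\<lambda>u. j # k # u) (src w t)
        else map_option (\<lambda>u. j # u) (src w (k # t))
      else if odd j then Some (1 # (j - 1) # k # t) else Some (2 # (j - 2) # k # t))"

fun crit :: "nat \<Rightarrow> nat list \<Rightarrow> bool" where
  "crit w [] = True"
| "crit w [j] = (j \<le> 2)"
| "crit w (j # k # t) = (j \<le> 2 \<and> (if even k then w < j + k \<and> crit w t else crit w (k # t)))"

text \<open>The argument \<open>p\<close> is the preceding block, 0 at the beginning. Even blocks following 1 or 2 are
  compared in reverse, because a pair \<open>p # k\<close> that is too large to be merged must precede the words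
  obtained by splitting \<open>k\<close>.\<close>

fun key :: "nat \<Rightarrow> nat \<Rightarrow> nat list \<Rightarrow> nat list" where
  "key w p [] = []"
| "key w p (k # t) = (if (p = 1 \<or> p = 2) \<and> even k then 2 * w - k else k) # key w k t"

text \<open>The leading term of a chain is its smallest word in this order. Words with the same
  first block are compared further after that block (\<open>key_less_Cons\<close>), so the order
  follows the recursions.\<close>

definition key_less :: "nat \<Rightarrow> nat \<Rightarrow> nat list \<Rightarrow> nat list \<Rightarrow> bool" where
  "key_less w p u v \<longleftrightarrow> (key w p u, key w p v) \<in> lexord {(x, y). x < y}"

lemma key_less_irrefl: "\<not> key_less w p u u"
  unfolding key_less_def by (rule lexord_irreflexive) auto

lemma key_less_trans: "key_less w p u v \<Longrightarrow> key_less w p v x \<Longrightarrow> key_less w p u x"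
  unfolding key_less_def by (rule lexord_trans) (auto intro: transI)

lemma key_less_Cons: "key_less w p (k # u) (k # v) \<longleftrightarrow> key_less w k u v"
  by (simp add: key_less_def)

lemma key_less_hd: "(if (p = 1 \<or> p = 2) \<and> even j then 2 * w - j else j)
    < (if (p = 1 \<or> p = 2) \<and> even k then 2 * w - k else k) \<Longrightarrow> key_less w p (j # u) (k # v)"
  by (simp add: key_less_def)

abbreviation word :: "nat \<Rightarrow> nat list \<Rightarrow> bool" where
  "word w u \<equiv> \<forall>k\<in>set u. 0 < k \<and> k \<le> w"

section \<open>The matching on words\<close>

text \<open>An odd block loses 1 and an even block loses 2, so the parity of the head survives. The
  recursions branch on this parity, hence the new word is read in the same way as the old
  one.\<close>

lemma src_head: "src w g = Some f \<Longrightarrow> word w g \<Longrightarrow> f \<noteq> [] \<and> even (hd f) = even (hd g)"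
  by (cases "(w,g)" rule: src.cases) (auto split: if_splits)

lemma tgt_head: "tgt w f = Some g \<Longrightarrow> f \<noteq> [] \<and> g \<noteq> [] \<and> even (hd f) = even (hd g)"
  by (cases "(w,f)" rule: tgt.cases) (auto split: if_splits)

text \<open>Induction along the recursion of \<open>tgt\<close>, \<open>src\<close> and
  \<open>crit\<close>: two blocks are consumed if the second is even, one if it is odd.\<close>

lemma word_induct:
  assumes "P []" "\<And>j. P [j]" "\<And>j k t. (even k \<Longrightarrow> P t) \<Longrightarrow> (odd k \<Longrightarrow> P (k # t)) \<Longrightarrow> P (j # k # t)"
  shows "P u"
  using assms by (induction u rule: induct_list012) auto

lemma src_word:
  "src w g = Some f \<Longrightarrow> word w g \<Longrightarrow>
     word w f \<and> sum_list f = sum_list g \<and> length f = Suc (length g)"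
  by (induction g arbitrary: f rule: word_induct) (auto split: if_splits)

lemma tgt_Cons_odd:
  "j = 1 \<or> j = 2 \<Longrightarrow> f \<noteq> [] \<Longrightarrow> odd (hd f) \<Longrightarrow> tgt w (j # f) = map_option ((#) j) (tgt w f)"
  by (cases f) auto

lemma src_Cons_odd:
  "j \<le> 2 \<Longrightarrow> g \<noteq> [] \<Longrightarrow> odd (hd g) \<Longrightarrow> src w (j # g) = map_option ((#) j) (src w g)"
  by (cases g) auto

text \<open>The two parts of a split block form the first mergeable place of the new word: the
  second part is even, their sum is at most \<open>w\<close>, and by \<open>src_head\<close>
  everything before them is read as before.\<close>

lemma src_tgt: "src w g = Some f \<Longrightarrow> word w g \<Longrightarrow> tgt w f = Some g"
proof (induction g arbitrary: f rule: word_induct)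
  case (3 j k t)
  have *: "tgt w (j # u) = Some (j # k # t)"
    if "src w (k # t) = Some u" "odd k" "tgt w u = Some (k # t)" "j \<le> 2" for u
    using src_head[OF that(1)] 3(4) that by (subst tgt_Cons_odd) auto
  show ?case
  proof (cases "even k")
    case True
    with 3 show ?thesis
      by (auto split: if_splits simp: not_le)
  next
    case False
    with 3 show ?thesis
      by (auto split: if_splits simp: not_le intro!: *)
  qed
qed (auto split: if_splits)

lemma tgt_src: "tgt w f = Some g \<Longrightarrow> word w f \<Longrightarrow> src w g = Some f \<and> word w g"
proof (induction f arbitrary: g rule: word_induct)
  case (3 j k t)
  have *: "src w (j # u) = Some (j # k # t)"
    if "tgt w (k # t) = Some u" "odd k" "src w u = Some (k # t)" "j \<le> 2" for u
    using tgt_head[OF that(1)] that by (subst src_Cons_odd) auto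
  have **: "src w ((j + k) # t) = Some (j # k # t)" if "j = 1 \<or> j = 2" "even k" "k > 0"
    using that by (cases t) (auto elim!: evenE)
  show ?case
  proof (cases "even k")
    case True
    with 3 ** show ?thesis
      by (auto split: if_splits)
  next
    case False
    with 3(3) obtain u where u: "tgt w (k # t) = Some u" "g = j # u" "j \<le> 2"
      by (auto split: if_splits)
    with 3(2)[OF False u(1)] 3(4) *[OF u(1) False] show ?thesis
      by simp
  qed
qed auto

lemma crit_iff: "word w u \<Longrightarrow> crit w u \<longleftrightarrow> src w u = None \<and> tgt w u = None"
  by (induction u rule: word_induct) auto

lemma not_src_tgt: "word w u \<Longrightarrow> src w u = None \<or> tgt w u = None"
  by (induction u rule: word_induct) auto

section \<open>Linearity and supports\<close>

lemma bd_eval_zero: "(\<And>u. \<phi> u = 0) \<Longrightarrow> bd_eval \<phi> g = 0"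
  by (induction g arbitrary: \<phi>) auto

lemma cycle_eval_zero: "(\<And>u. \<phi> u = 0) \<Longrightarrow> cycle_eval \<phi> g = 0"
  by (induction g arbitrary: \<phi> rule: word_induct) auto

lemma bd_eval_sum: "bd_eval (\<lambda>u. \<Sum>a\<in>A. c a * \<phi> a u) g = (\<Sum>a\<in>A. c a * bd_eval (\<phi> a) g)"
proof (induction g arbitrary: \<phi>)
  case (Cons k t)
  have "(\<Sum>i = 1..<k. split_coeff i (k - i) * (\<Sum>a\<in>A. c a * \<phi> a (i # (k - i) # t)))
      = (\<Sum>a\<in>A. c a * (\<Sum>i = 1..<k. split_coeff i (k - i) * \<phi> a (i # (k - i) # t)))"
    unfolding sum_distrib_left by (subst sum.swap) (simp add: mult.left_commute)
  then show ?case
    by (simp add: Cons sum_distrib_left distrib_left sum.distrib mult.left_commute)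
qed simp

lemma cycle_eval_sum: "cycle_eval (\<lambda>u. \<Sum>a\<in>A. c a * \<phi> a u) g = (\<Sum>a\<in>A. c a * cycle_eval (\<phi> a) g)"
proof (induction g arbitrary: \<phi> rule: word_induct)
  case (3 j k t)
  show ?case
  proof (cases "even k")
    case True
    have "(\<Sum>i = 1..<j + k. split_coeff i (j + k - i) * (\<Sum>a\<in>A. c a * cycle_eval (\<lambda>u. \<phi> a (i # (j
        + k - i) # u)) t))
      = (\<Sum>a\<in>A. c a * (\<Sum>i = 1..<j + k. split_coeff i (j + k - i) * cycle_eval (\<lambda>u. \<phi> a (i # (j + k
          - i) # u)) t))"
      unfolding sum_distrib_left by (subst sum.swap) (simp add: mult.left_commute)
    then show ?thesis
      using True 3 by simp
  qed (use 3 in simp)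
qed simp_all

text \<open>A sum over the two truth values serves as a binary linear combination.\<close>

lemma cycle_eval_lin: "cycle_eval (\<lambda>u. \<phi> u + c * \<psi> u) g = cycle_eval \<phi> g + c * cycle_eval \<psi> g"
  using cycle_eval_sum[of "\<lambda>b. if b then 1 else c" "\<lambda>b. if b then \<phi> else \<psi>" UNIV g]
  by (simp add: UNIV_bool add.commute)

text \<open>Supports are expressed dually: a functional that vanishes on all words that may occur
  vanishes on the boundary.\<close>

lemma bd_eval_supp:
  assumes "word w g"
    "\<And>u. word w u \<Longrightarrow> sum_list u = sum_list g \<Longrightarrow> length u = Suc (length g) \<Longrightarrow> \<phi> u = 0"
  shows "bd_eval \<phi> g = 0"
  using assms
proof (induction g arbitrary: \<phi>)
  case (Cons k t)
  have "bd_eval (\<lambda>u. \<phi> (k # u)) t = 0"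
    using Cons(2) by (intro Cons) auto
  moreover have "\<phi> (i # (k - i) # t) = 0" if "i \<in> {1..<k}" for i
    using that Cons(2) by (intro Cons) auto
  ultimately show ?case
    by simp
qed simp

text \<open>Although \<open>j + k\<close> exceeds \<open>w\<close>, its boundary stays within the
  width: a part larger than \<open>w\<close> occurs only for \<open>j = 2\<close> and
  \<open>k = w\<close>, and then the parts are 1 and \<open>w + 1\<close>, both odd, with
  coefficient zero.\<close>

lemma cycle_eval_supp:
  assumes "crit w g" "word w g"
    "\<And>u. word w u \<Longrightarrow> sum_list u = sum_list g \<Longrightarrow> length u = length g \<Longrightarrow> \<phi> u = 0"
  shows "cycle_eval \<phi> g = 0"
  using assms
proof (induction g arbitrary: \<phi> rule: word_induct)
  case (3 j k t)
  show ?case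
  proof (cases "even k")
    case True
    have "split_coeff i (j + k - i) * cycle_eval (\<lambda>u. \<phi> (i # (j + k - i) # u)) t = 0"
        if i: "i \<in> {1..<j + k}" for i
    proof (cases "i \<le> w \<and> j + k - i \<le> w")
      case T: True
      have "cycle_eval (\<lambda>u. \<phi> (i # (j + k - i) # u)) t = 0"
        using T True 3(3,4) i by (intro 3(1)) (auto intro!: 3(5))
      then show ?thesis by simp
    next
      case False
      then have "j = 2" and "i = 1 \<or> i = k + 1"
        using 3(3,4) i by auto
      then show ?thesis
        using True by (auto simp: split_coeff_odd_odd)
    qed
    then show ?thesis
      using True by (simp add: sum.neutral)
  next
    case False
    have "cycle_eval (\<lambda>u. \<phi> (j # u)) (k # t) = 0"
      using False 3(3,4) by (intro 3(2)) (auto intro!: 3(5))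
    then show ?thesis
      using False by simp
  qed
qed auto

section \<open>Leading terms of boundaries and cycles\<close>

text \<open>Blocks of weight 1 and 2 have zero boundary: 1 cannot be split, and 2 splits only into
  two odd parts.\<close>

lemma split_coeff_small_sum: "j = 1 \<or> j = 2 \<Longrightarrow> (\<Sum>i = 1..<j. split_coeff i (j - i) * \<psi> i) = 0"
  by (auto simp: numeral_2_eq_2 split_coeff_odd_odd)

text \<open>The case where the first block is the one to be split. That \<open>f\<close> is the
  leading term is again stated dually: a functional vanishing on all larger words sees only
  \<open>f\<close>.\<close>

lemma bd_eval_lead_base:
  assumes "word w (k # t)" "2 < k" "src w (k # t) = Some f" "p = 1 \<or> p = 2 \<Longrightarrow> odd k \<or> w \<le> 3"
  shows "\<exists>c. c \<noteq> 0 \<and> (\<forall>\<phi>. (\<forall>u. key_less w p f u \<longrightarrow> \<phi> u = 0) \<longrightarrow> bd_eval \<phi> (k # t) = c * \<phi> f)"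
proof -
  \<comment> \<open>The weight that \<open>src\<close> splits off, which is the least
    \<open>i\<close> with a nonzero coefficient.\<close>
  define m :: nat where "m = (if odd k then 1 else 2)"
  have m: "m < k" "even (k - m)" "m > 0" and f: "f = m # (k - m) # t"
    using assms by (auto simp: m_def split: if_splits) (cases t; auto)+
  \<comment> \<open>If \<open>w \<le> 3\<close>, then \<open>k > 2\<close> leaves only
    \<open>k = 3\<close>.\<close>
  have k: "p = 1 \<or> p = 2 \<Longrightarrow> odd k" "k \<le> w"
    using assms by auto
  have lt: "split_coeff i (k - i) = 0 \<or> key_less w p (m # u) (i # v)" if "0 < i" "i \<le> k" "i \<noteq> m"
      for i u v
  proof (cases "even k \<and> odd i")
    case True
    with that have "odd (k - i)" by auto
    with True show ?thesis by (auto simp: split_coeff_odd_odd)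
  next
    case False
    with that k m have "key_less w p (m # u) (i # v)"
      by (intro key_less_hd) (auto simp: m_def elim!: evenE oddE split: if_splits)
    then show ?thesis ..
  qed
  have "key_less w p (m # u) (k # v)" for u v
    using m k by (intro key_less_hd) (auto simp: m_def)
  note lt = lt this
  show ?thesis
  proof (intro exI conjI allI impI)
    show "split_coeff m (k - m) \<noteq> 0"
      by (rule split_coeff_nonzero) fact
    fix \<phi> :: "nat list \<Rightarrow> rat" assume \<phi>: "\<forall>u. key_less w p f u \<longrightarrow> \<phi> u = 0"
    have "split_coeff i (k - i) * \<phi> (i # (k - i) # t) = 0" if "0 < i" "i \<le> k" "i \<noteq> m" for i
      using lt(1)[OF that, of "(k - m) # t" "(k - i) # t"] \<phi> f by auto
    then have "(\<Sum>i = 1..<k. split_coeff i (k - i) * \<phi> (i # (k - i) # t))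
        = (\<Sum>i\<in>{m}. split_coeff i (k - i) * \<phi> (i # (k - i) # t))"
      using m by (intro sum.mono_neutral_right) auto
    moreover have "bd_eval (\<lambda>u. \<phi> (k # u)) t = 0"
      by (rule bd_eval_zero) (use \<phi> f lt(2) in auto)
    ultimately show "bd_eval \<phi> (k # t) = split_coeff m (k - m) * \<phi> f"
      by (simp add: f)
  qed
qed

text \<open>Before the matched place, blocks 1 and 2 have no boundary, and splitting the even block
  of an oversized pair gives larger words thanks to the reversed comparison. The assumption on
  \<open>p\<close> prevents an unwanted reversal at the head; it holds trivially for
  \<open>p = 0\<close>.\<close>

lemma bd_eval_lead:
  assumes "word w g" "src w g = Some f" "p = 1 \<or> p = 2 \<Longrightarrow> odd (hd g) \<or> w \<le> 3"
  shows "\<exists>c. c \<noteq> 0 \<and> (\<forall>\<phi>. (\<forall>u. key_less w p f u \<longrightarrow> \<phi> u = 0) \<longrightarrow> bd_eval \<phi> g = c * \<phi> f)"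
  using assms
proof (induction g arbitrary: p f rule: word_induct)
  case (2 j)
  then show ?case
    using bd_eval_lead_base[where w = w and k = j and t = "[]" and f = f and p = p]
      by (simp split: if_splits)
next
  case (3 j k t)
  consider "j > 2" | "j = 1 \<or> j = 2" "even k" | "j = 1 \<or> j = 2" "odd k"
    using 3(3) by fastforce
  then show ?case
  proof cases
    case 1
    with 3 show ?thesis
      using bd_eval_lead_base[where w = w and k = j and t = "k # t" and f = f and p = p] by simp
  next
    case 2
    with 3(4) obtain f' where f': "src w t = Some f'" and f: "f = j # k # f'" and w: "w < j + k"
      by (auto split: if_splits)
    \<comment> \<open>For \<open>w > 3\<close> the inequality \<open>w < j + k\<close> forces
      \<open>k > 2\<close>, so nothing is reversed at the head of \<open>t\<close>.\<close>
    have "\<exists>c. c \<noteq> 0 \<and> (\<forall>\<phi>. (\<forall>u. key_less w k f' u \<longrightarrow> \<phi> u = 0) \<longrightarrow> bd_eval \<phi> t = c * \<phi> f')"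
      using 2 3(3) w f' by (intro 3(1)) auto
    then obtain c where c: "c \<noteq> 0" "\<And>\<phi>. (\<forall>u. key_less w k f' u \<longrightarrow> \<phi> u = 0) \<Longrightarrow> bd_eval \<phi> t = c * \<phi> f'"
      by blast
    show ?thesis
    proof (intro exI conjI allI impI)
      show "(- 1) ^ (j - 1) * (- 1) ^ (k - 1) * c \<noteq> 0"
        using c by simp
      fix \<phi> :: "nat list \<Rightarrow> rat" assume \<phi>: "\<forall>u. key_less w p f u \<longrightarrow> \<phi> u = 0"
      have "bd_eval (\<lambda>u. \<phi> (j # k # u)) t = c * \<phi> f"
        using c(2)[of "\<lambda>u. \<phi> (j # k # u)"] \<phi> by (simp add: f key_less_Cons)
      moreover have "(\<Sum>i = 1..<k. split_coeff i (k - i) * \<phi> (j # i # (k - i) # t)) = 0"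
      proof (rule sum.neutral, rule ballI)
        fix i assume i: "i \<in> {1..<k}"
        show "split_coeff i (k - i) * \<phi> (j # i # (k - i) # t) = 0"
        proof (cases "odd i")
          case True
          with i 2 show ?thesis by (simp add: split_coeff_odd_odd)
        next
          case False
          \<comment> \<open>Both even blocks follow 1 or 2 and compare in reverse, so the smaller
            \<open>i\<close> comes later.\<close>
          then have "key_less w j (k # f') (i # (k - i) # t)"
            using i 2 3(3) by (intro key_less_hd) auto
          then show ?thesis
            using \<phi> by (simp add: f key_less_Cons)
        qed
      qed
      moreover have "(\<Sum>i = 1..<j. split_coeff i (j - i) * \<phi> (i # (j - i) # k # t)) = 0"
        using 2 by (intro split_coeff_small_sum)
      ultimately show "bd_eval \<phi> (j # k # t) = (- 1) ^ (j - 1) * (- 1) ^ (k - 1) * c * \<phi> f"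
        by simp
    qed
  next
    case single: 3
    with 3(4) obtain f' where f': "src w (k # t) = Some f'" and f: "f = j # f'"
      by (auto split: if_splits)
    have "\<exists>c. c \<noteq> 0 \<and> (\<forall>\<phi>. (\<forall>u. key_less w j f' u \<longrightarrow> \<phi> u = 0) \<longrightarrow> bd_eval \<phi> (k # t) = c * \<phi> f')"
      using single 3(3) f' by (intro 3(2)) auto
    then obtain c where c: "c \<noteq> 0" "\<And>\<phi>. (\<forall>u. key_less w j f' u \<longrightarrow> \<phi> u = 0)
        \<Longrightarrow> bd_eval \<phi> (k # t) = c * \<phi> f'"
      by blast
    show ?thesis
    proof (intro exI conjI allI impI)
      show "(- 1) ^ (j - 1) * c \<noteq> 0"
        using c by simp
      fix \<phi> :: "nat list \<Rightarrow> rat" assume \<phi>: "\<forall>u. key_less w p f u \<longrightarrow> \<phi> u = 0"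
      have "bd_eval (\<lambda>u. \<phi> (j # u)) (k # t) = c * \<phi> f"
        using c(2)[of "\<lambda>u. \<phi> (j # u)"] \<phi> by (simp add: f key_less_Cons)
      moreover have "(\<Sum>i = 1..<j. split_coeff i (j - i) * \<phi> (i # (j - i) # k # t)) = 0"
        using single by (intro split_coeff_small_sum)
      ultimately show "bd_eval \<phi> (j # k # t) = (- 1) ^ (j - 1) * c * \<phi> f"
        by (simp add: bd_eval.simps(2)[of \<phi> j])
    qed
  qed
qed simp

text \<open>In the boundary of \<open>j + k\<close> with \<open>k\<close> even, \<open>j\<close> is
  the least part with nonzero coefficient: nothing is below 1, and for \<open>j = 2\<close> the
  total is even, so that odd parts drop out. Each pair thus contributes the nonzero factor
  \<open>split_coeff j k\<close>.\<close>

lemma cycle_eval_lead: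
  assumes "word w g" "crit w g" "p = 1 \<or> p = 2 \<Longrightarrow> g = [] \<or> odd (hd g) \<or> w \<le> 3"
  shows "\<exists>c. c \<noteq> 0 \<and> (\<forall>\<phi>. (\<forall>u. key_less w p g u \<longrightarrow> \<phi> u = 0) \<longrightarrow> cycle_eval \<phi> g = c * \<phi> g)"
  using assms
proof (induction g arbitrary: p rule: word_induct)
  case 1
  then show ?case by (auto intro!: exI[of _ 1])
next
  case (2 j)
  then show ?case by (auto intro!: exI[of _ 1])
next
  case (3 j k t)
  then have j: "j = 1 \<or> j = 2"
    by auto
  show ?case
  proof (cases "even k")
    case True
    have w: "w < j + k" "crit w t"
      using 3(4) True by auto
    have "\<exists>c. c \<noteq> 0 \<and> (\<forall>\<phi>. (\<forall>u. key_less w k t u \<longrightarrow> \<phi> u = 0) \<longrightarrow> cycle_eval \<phi> t = c * \<phi> t)"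
      using True 3(3) w j by (intro 3(1)) auto
    then obtain c where c: "c \<noteq> 0" "\<And>\<phi>. (\<forall>u. key_less w k t u \<longrightarrow> \<phi> u = 0) \<Longrightarrow> cycle_eval \<phi> t = c * \<phi> t"
      by blast
    show ?thesis
    proof (intro exI conjI allI impI)
      show "split_coeff j k * c \<noteq> 0"
        using c True by (simp add: split_coeff_nonzero)
      fix \<phi> :: "nat list \<Rightarrow> rat" assume \<phi>: "\<forall>u. key_less w p (j # k # t) u \<longrightarrow> \<phi> u = 0"
      have "split_coeff i (j + k - i) * cycle_eval (\<lambda>u. \<phi> (i # (j + k - i) # u)) t = 0"
        if i: "i \<in> {1..<j + k} - {j}" for i
      proof (cases "odd i \<and> odd (j + k - i)")
        case True
        then show ?thesis by (simp add: split_coeff_odd_odd)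
      next
        case False
        have "key_less w p (j # k # t) (i # (j + k - i) # u)" for u
        proof (cases "j = 1")
          case True
          then show ?thesis
            using 3(3) i by (intro key_less_hd) auto
        next
          case j2: False
          with j False i True have i2: "even i" "i > 2" "i \<le> k"
            by (auto elim!: evenE oddE)
          have "\<not> w \<le> 3"
          proof
            assume "w \<le> 3"
            with 3(3) True have "k = 2"
              by (auto simp: le_Suc_eq numeral_3_eq_3)
            with i2 show False by simp
          qed
          then show ?thesis
            using 3(5) i2 j j2 by (intro key_less_hd) auto
        qed
        then have "cycle_eval (\<lambda>u. \<phi> (i # (j + k - i) # u)) t = 0"
          using \<phi> by (intro cycle_eval_zero) auto
        then show ?thesis by simp
      qed
      then have "cycle_eval \<phi> (j # k # t) = (\<Sum>i\<in>{j}. split_coeff i (j + k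
          - i) * cycle_eval (\<lambda>u. \<phi> (i # (j + k - i) # u)) t)"
        using True 3(3) unfolding cycle_eval.simps
          by (simp only: if_True) (intro sum.mono_neutral_right, auto)
      also have "\<dots> = split_coeff j k * c * \<phi> (j # k # t)"
        using c(2)[of "\<lambda>u. \<phi> (j # k # u)"] \<phi> by (simp add: key_less_Cons)
      finally show "cycle_eval \<phi> (j # k # t) = split_coeff j k * c * \<phi> (j # k # t)" .
    qed
  next
    case False
    have "\<exists>c. c \<noteq> 0 \<and> (\<forall>\<phi>. (\<forall>u. key_less w j (k # t) u \<longrightarrow> \<phi> u = 0) \<longrightarrow> cycle_eval \<phi> (k # t)
        = c * \<phi> (k # t))"
      using False 3(3,4) by (intro 3(2)) auto
    then obtain c where c: "c \<noteq> 0"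
      "\<And>\<phi>. (\<forall>u. key_less w j (k # t) u \<longrightarrow> \<phi> u = 0) \<Longrightarrow> cycle_eval \<phi> (k # t) = c * \<phi> (k # t)"
      by blast
    show ?thesis
    proof (intro exI conjI allI impI)
      show "c \<noteq> 0" by fact
      fix \<phi> :: "nat list \<Rightarrow> rat" assume "\<forall>u. key_less w p (j # k # t) u \<longrightarrow> \<phi> u = 0"
      then show "cycle_eval \<phi> (j # k # t) = c * \<phi> (j # k # t)"
        using c(2)[of "\<lambda>u. \<phi> (j # u)"] False by (simp add: key_less_Cons)
    qed
  qed
qed

section \<open>Vanishing of the boundary on boundaries and cycles\<close>

text \<open>Each triple of parts with sum \<open>N\<close> is reached twice, by making either of its
  two cuts first, and \<open>split_coeff_assoc\<close> cancels the two terms.\<close>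

lemma split_coeff_square_zero:
  "(\<Sum>i = 1..<N. split_coeff i (N - i) * ((\<Sum>a = 1..<i. split_coeff a (i - a) * \<psi> a (i - a) (N - i))
     + (- 1) ^ (i - 1) * (\<Sum>b = 1..<N - i. split_coeff b (N - i - b) * \<psi> i b (N - i - b)))) = 0"
proof -
  let ?S = "SIGMA i:{1..<N}. {1..<N - i}"
  have "(\<Sum>i = 1..<N. split_coeff i (N - i) * (\<Sum>a
      = 1..<i. split_coeff a (i - a) * \<psi> a (i - a) (N - i)))
      = (\<Sum>(i, a)\<in>(SIGMA i:{1..<N}. {1..<i}). split_coeff i (N - i) * split_coeff a (i
          - a) * \<psi> a (i - a) (N - i))"
    by (subst sum.Sigma[symmetric]) (auto simp: sum_distrib_left mult.assoc)
  also have "\<dots> = (\<Sum>(i, b)\<in>?S. split_coeff (i + b) (N - i - b) * split_coeff i b * \<psi> i b (N - i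
      - b))"
    \<comment> \<open>A cut at \<open>i\<close> refined at \<open>a\<close> is recorded by its first
      two parts \<open>a\<close> and \<open>i - a\<close>.\<close>
    by (rule sum.reindex_bij_witness[of _ "\<lambda>(i, b). (i + b, i)" "\<lambda>(i, a). (a, i - a)"]) auto
  finally have 1: "(\<Sum>i = 1..<N. split_coeff i (N - i) * (\<Sum>a
      = 1..<i. split_coeff a (i - a) * \<psi> a (i - a) (N - i))) = \<dots>" .
  have 2: "(\<Sum>i = 1..<N. split_coeff i (N - i) * ((- 1) ^ (i - 1) * (\<Sum>b
      = 1..<N - i. split_coeff b (N - i - b) * \<psi> i b (N - i - b))))
      = (\<Sum>(i, b)\<in>?S. (- 1) ^ (i - 1) * split_coeff i (N - i) * split_coeff b (N - i
          - b) * \<psi> i b (N - i - b))"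
    by (subst sum.Sigma[symmetric]) (auto simp: sum_distrib_left mult_ac)
  have "split_coeff (i + b) (N - i - b) * split_coeff i b * \<psi> i b (N - i - b)
      + (- 1) ^ (i - 1) * split_coeff i (N - i) * split_coeff b (N - i - b) * \<psi> i b (N - i - b) = 0"
    if "(i, b) \<in> ?S" for i b
  proof -
    have "b + (N - i - b) = N - i"
      using that by auto
    then have "split_coeff (i + b) (N - i - b) * split_coeff i b + (- 1) ^ (i
        - 1) * split_coeff i (N - i) * split_coeff b (N - i - b) = 0"
      using split_coeff_assoc[of i b "N - i - b"] that by auto
    then show ?thesis
      by (metis distrib_right mult_zero_left)
  qed
  then have "(\<Sum>(i, b)\<in>?S. split_coeff (i + b) (N - i - b) * split_coeff i b * \<psi> i b (N - i - b)
      + (- 1) ^ (i - 1) * split_coeff i (N - i) * split_coeff b (N - i - b) * \<psi> i b (N - i - b))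
          = 0"
    by (intro sum.neutral) auto
  then show ?thesis
    unfolding distrib_left sum.distrib 1 2 by (simp add: sum.distrib case_prod_unfold)
qed

text \<open>The chain attached to \<open>g\<close> is a concatenation of cycles, namely blocks of
  weight 1 or 2 and boundaries of blocks \<open>j + k\<close>, hence a cycle by the Leibniz
  rule.\<close>

lemma cycle_eval_bd_eval: "word w g \<Longrightarrow> crit w g \<Longrightarrow> cycle_eval (bd_eval \<phi>) g = 0"
proof (induction g arbitrary: \<phi> rule: word_induct)
  case (2 j)
  then have "j = 1 \<or> j = 2" by auto
  then show ?case using split_coeff_small_sum[of j] by simp
next
  case (3 j k t)
  then have j: "j = 1 \<or> j = 2"
    by auto
  show ?case
  proof (cases "even k")
    case True
    define N where "N = j + k"
    \<comment> \<open>\<open>?A\<close> and \<open>?B\<close> split the first and the second part of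
      the pair and cancel together; \<open>?C\<close> takes the boundary of the tail, which the
      induction hypothesis kills.\<close>
    let ?A = "\<lambda>i u. \<Sum>a = 1..<i. split_coeff a (i - a) * \<phi> (a # (i - a) # (N - i) # u)"
    let ?B = "\<lambda>i u. \<Sum>b = 1..<N - i. split_coeff b (N - i - b) * \<phi> (i # b # (N - i - b) # u)"
    let ?C = "\<lambda>i. bd_eval (\<lambda>v. \<phi> (i # (N - i) # v))"
    have split: "bd_eval \<phi> (i # (N - i) # u)
        = ?A i u + (- 1) ^ (i - 1) * ?B i u + ((- 1) ^ (i - 1) * (- 1) ^ (N - i - 1)) * ?C i u"
            for i u
      by (simp add: algebra_simps)
    have C: "cycle_eval (?C i) t = 0" for i
      using 3(3,4) True by (intro 3(1)) auto
    have "cycle_eval (bd_eval \<phi>) (j # k # t)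
        = (\<Sum>i = 1..<N. split_coeff i (N - i) * cycle_eval (\<lambda>u. bd_eval \<phi> (i # (N - i) # u)) t)"
      using True by (simp add: N_def)
    also have "\<dots> = (\<Sum>i = 1..<N. split_coeff i (N - i) * cycle_eval (\<lambda>u. ?A i u + (- 1) ^ (i
        - 1) * ?B i u) t)"
      unfolding split cycle_eval_lin[of _ "_ * _"] C by simp
    also have "\<dots> = cycle_eval (\<lambda>u. \<Sum>i = 1..<N. split_coeff i (N - i) * (?A i u + (- 1) ^ (i
        - 1) * ?B i u)) t"
      by (rule cycle_eval_sum[symmetric])
    also have "\<dots> = 0"
      by (rule cycle_eval_zero, rule split_coeff_square_zero)
    finally show ?thesis .
  next
    case False
    have "(\<lambda>u. bd_eval \<phi> (j # u)) = (\<lambda>u. 0 + (- 1) ^ (j - 1) * bd_eval (\<lambda>v. \<phi> (j # v)) u)"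
      using split_coeff_small_sum[OF j] by simp
    then have "cycle_eval (bd_eval \<phi>) (j # k # t)
        = (- 1) ^ (j - 1) * cycle_eval (bd_eval (\<lambda>v. \<phi> (j # v))) (k # t)"
      using False by (simp only: cycle_eval.simps if_False cycle_eval_lin) (simp add:
        cycle_eval_zero)
    then show ?thesis
      using 3(2)[OF False] 3(3,4) False by simp
  qed
qed simp

lemma bd_eval_lin: "bd_eval (\<lambda>u. \<phi> u + c * \<psi> u) g = bd_eval \<phi> g + c * bd_eval \<psi> g"
  using bd_eval_sum[of "\<lambda>b. if b then 1 else c" "\<lambda>b. if b then \<phi> else \<psi>" UNIV g]
  by (simp add: UNIV_bool add.commute)

lemma bd_eval_bd_eval: "0 \<notin> set g \<Longrightarrow> bd_eval (bd_eval \<phi>) g = 0"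
proof (induction g arbitrary: \<phi>)
  case (Cons k t)
  let ?A = "\<lambda>i. \<Sum>a = 1..<i. split_coeff a (i - a) * \<phi> (a # (i - a) # (k - i) # t)"
  let ?B = "\<lambda>i. \<Sum>b = 1..<k - i. split_coeff b (k - i - b) * \<phi> (i # b # (k - i - b) # t)"
  let ?C = "\<lambda>i. bd_eval (\<lambda>u. \<phi> (i # (k - i) # u)) t"
  \<comment> \<open>The two parts have total dimension one less than the block, so splitting the
    block and the tail in either order gives opposite signs.\<close>
  have "(- 1) ^ (i - 1) * (- 1) ^ (k - i - 1) = - ((- 1 :: rat) ^ (k - 1))" if "i \<in> {1..<k}" for i
  proof -
    have "k - 1 = Suc ((i - 1) + (k - i - 1))"
      using that by auto
    then show ?thesis
      by (simp only: power_Suc power_add)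
  qed
  note sgn = this
  have "split_coeff i (k - i) * bd_eval \<phi> (i # (k - i) # t)
      = split_coeff i (k - i) * (?A i + (- 1) ^ (i - 1) * ?B i) - (- 1) ^ (k
          - 1) * (split_coeff i (k - i) * ?C i)"
    if "i \<in> {1..<k}" for i
  proof -
    have "bd_eval \<phi> (i # (k - i) # t) = ?A i + (- 1) ^ (i - 1) * ?B i + ((- 1) ^ (i
        - 1) * (- 1) ^ (k - i - 1)) * ?C i"
      by (simp only: bd_eval.simps distrib_left mult.assoc add.assoc)
    then show ?thesis
      unfolding sgn[OF that] by (simp only: algebra_simps minus_mult_left[symmetric])
  qed
  then have "(\<Sum>i = 1..<k. split_coeff i (k - i) * bd_eval \<phi> (i # (k - i) # t))
      = (\<Sum>i = 1..<k. split_coeff i (k - i) * (?A i + (- 1) ^ (i - 1) * ?B i) - (- 1) ^ (k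
          - 1) * (split_coeff i (k - i) * ?C i))"
    by (rule sum.cong[OF refl])
  also have "\<dots> = - ((- 1) ^ (k - 1) * (\<Sum>i = 1..<k. split_coeff i (k - i) * ?C i))"
    using split_coeff_square_zero[of k "\<lambda>a b c. \<phi> (a # b # c # t)"]
    by (simp add: sum_subtractf sum_distrib_left)
  finally have 1: "(\<Sum>i = 1..<k. split_coeff i (k - i) * bd_eval \<phi> (i # (k - i) # t)) = \<dots>" .
  have 2: "bd_eval (\<lambda>u. bd_eval \<phi> (k # u)) t = (\<Sum>i
      = 1..<k. split_coeff i (k - i) * ?C i) + (- 1) ^ (k
          - 1) * bd_eval (bd_eval (\<lambda>v. \<phi> (k # v))) t"
    by (simp only: bd_eval.simps bd_eval_lin bd_eval_sum)
  have 3: "bd_eval (bd_eval (\<lambda>v. \<phi> (k # v))) t = 0"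
    using Cons by auto
  show ?case
    unfolding bd_eval.simps(2)[of "bd_eval \<phi>" k t] 1 2 3 by simp
qed simp

section \<open>Coefficients of boundaries and cycles\<close>

definition words :: "nat \<Rightarrow> nat \<Rightarrow> nat list set" where
  "words n w = {u. word w u \<and> sum_list u = n}"

lemma length_word_le: "word w u \<Longrightarrow> length u \<le> sum_list u"
  by (induction u) auto

lemma finite_words: "finite (words n w)"
proof (rule finite_subset)
  show "words n w \<subseteq> {u. set u \<subseteq> {..w} \<and> length u \<le> n}"
    using length_word_le by (auto simp: words_def)
qed (simp add: finite_lists_length_le)

text \<open>Used both as the functional reading off the coefficient of a word and as the chain
  consisting of a single cell.\<close>

abbreviation delta :: "'a \<Rightarrow> 'a \<Rightarrow> rat" where
  "delta u v \<equiv> if v = u then 1 else 0"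

lemma sum_delta_words:
  assumes "x \<in> words n w"
  shows "(\<Sum>u\<in>words n w. \<phi> u * delta u x) = \<phi> x"
proof -
  have "(\<Sum>u\<in>words n w - {x}. \<phi> u * delta u x) = 0"
    by (rule sum.neutral) auto
  then show ?thesis
    by (simp add: sum.remove[OF finite_words assms])
qed

text \<open>Interpolating \<open>\<phi>\<close> on the finitely many admissible words leaves a
  functional that vanishes there, so \<open>bd_eval_supp\<close> applies to the difference.
  Functionals thereby become matrix coefficients.\<close>

lemma bd_eval_expand:
  assumes "g \<in> words n w"
  shows "bd_eval \<phi> g = (\<Sum>u\<in>words n w. bd_eval (delta u) g * \<phi> u)"
proof -
  let ?\<psi> = "\<lambda>x. \<phi> x + (- 1) * (\<Sum>u\<in>words n w. \<phi> u * delta u x)"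
  have "bd_eval ?\<psi> g = 0"
    by (rule bd_eval_supp[where w = w])
      (use assms sum_delta_words[of _ n w \<phi>] in \<open>auto simp: words_def\<close>)
  then show ?thesis
    unfolding bd_eval_lin bd_eval_sum by (simp add: mult.commute)
qed

lemma cycle_eval_expand:
  assumes "g \<in> words n w" "crit w g"
  shows "cycle_eval \<phi> g = (\<Sum>u\<in>words n w. cycle_eval (delta u) g * \<phi> u)"
proof -
  let ?\<psi> = "\<lambda>x. \<phi> x + (- 1) * (\<Sum>u\<in>words n w. \<phi> u * delta u x)"
  have "cycle_eval ?\<psi> g = 0"
    by (rule cycle_eval_supp[OF assms(2)])
      (use assms sum_delta_words[of _ n w \<phi>] in \<open>auto simp: words_def\<close>)
  then show ?thesis
    unfolding cycle_eval_lin cycle_eval_sum by (simp add: mult.commute)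
qed

lemma bd_eval_delta_length:
  assumes "word w g" "bd_eval (delta u) g \<noteq> 0"
  shows "length u = Suc (length g)"
proof (rule ccontr)
  assume u: "length u \<noteq> Suc (length g)"
  have "bd_eval (delta u) g = 0"
    by (rule bd_eval_supp[OF assms(1)]) (use u in auto)
  with assms show False by simp
qed

lemma cycle_eval_delta_length:
  assumes "word w g" "crit w g" "cycle_eval (delta u) g \<noteq> 0"
  shows "length u = length g"
proof (rule ccontr)
  assume u: "length u \<noteq> length g"
  have "cycle_eval (delta u) g = 0"
    by (rule cycle_eval_supp[OF assms(2,1)]) (use u in auto)
  with assms show False by simp
qed

text \<open>Testing \<open>bd_eval_lead\<close> with \<open>delta u\<close> turns it into a
  statement on single coefficients.\<close>

lemma bd_eval_delta_lead:
  assumes "word w g" "src w g = Some f"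
  shows "bd_eval (delta f) g \<noteq> 0" "bd_eval (delta u) g \<noteq> 0 \<Longrightarrow> u \<noteq> f \<Longrightarrow> key_less w 0 f u"
proof -
  obtain c where c: "c \<noteq> 0" "\<And>\<phi>. (\<forall>u. key_less w 0 f u \<longrightarrow> \<phi> u = 0) \<Longrightarrow> bd_eval \<phi> g = c * \<phi> f"
    using bd_eval_lead[OF assms, of 0] by auto
  from c show "bd_eval (delta f) g \<noteq> 0"
    using key_less_irrefl[of w 0 f] c(2)[of "delta f"] by auto
  show "key_less w 0 f u" if "bd_eval (delta u) g \<noteq> 0" "u \<noteq> f"
  proof (rule ccontr)
    assume "\<not> ?thesis"
    then have "\<forall>v. key_less w 0 f v \<longrightarrow> delta u v = 0"
      by auto
    with c(2)[of "delta u"] that show False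
      by simp
  qed
qed

lemma cycle_eval_delta_lead:
  assumes "word w g" "crit w g"
  shows "cycle_eval (delta g) g \<noteq> 0" "cycle_eval (delta u) g \<noteq> 0 \<Longrightarrow> u \<noteq> g \<Longrightarrow> key_less w 0 g u"
proof -
  obtain c where c: "c \<noteq> 0" "\<And>\<phi>. (\<forall>u. key_less w 0 g u \<longrightarrow> \<phi> u = 0) \<Longrightarrow> cycle_eval \<phi> g = c * \<phi> g"
    using cycle_eval_lead[OF assms, of 0] by auto
  from c show "cycle_eval (delta g) g \<noteq> 0"
    using key_less_irrefl[of w 0 g] c(2)[of "delta g"] by auto
  show "key_less w 0 g u" if "cycle_eval (delta u) g \<noteq> 0" "u \<noteq> g"
  proof (rule ccontr)
    assume "\<not> ?thesis"
    then have "\<forall>v. key_less w 0 g v \<longrightarrow> delta u v = 0"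
      by auto
    with c(2)[of "delta u"] that show False
      by simp
  qed
qed

section \<open>Critical words\<close>

lemma crit_singletons: "u \<in> singletons \<Longrightarrow> crit w u"
proof -
  have "crit w (replicate j 1)" for j
  proof (induction j)
    case (Suc j)
    then show ?case by (cases j) auto
  qed simp
  then show "u \<in> singletons \<Longrightarrow> crit w u"
    by (auto simp: singletons_def)
qed

lemma singletons_hd: "u \<in> singletons \<Longrightarrow> u = [] \<or> hd u = 1"
  by (cases u) (auto simp: singletons_def Cons_replicate_eq)

lemma singletons_Cons: "1 # u \<in> singletons \<longleftrightarrow> u \<in> singletons"
  unfolding singletons_def by (auto simp: Cons_replicate_eq)

lemma crit_Cons_odd: "crit w g \<Longrightarrow> g = [] \<or> odd (hd g) \<Longrightarrow> j \<le> 2 \<Longrightarrow> crit w (j # g)"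
  by (cases g) auto

lemma crit_optional_two:
  "e \<in> optional_two \<Longrightarrow> crit w g \<Longrightarrow> g = [] \<or> hd g = 1 \<Longrightarrow> crit w (e @ g)"
  using crit_Cons_odd[of w g 2] by (auto simp: optional_two_def)

text \<open>For width 3 the pair is \<open>[2, 2]\<close>; a row of blocks 2 consists of such pairs,
  with one block left over if their number is odd. So width 3 is covered by the formula for odd
  width.\<close>

lemma critical_weights_3:
  "{replicate i 2 @ u | i u. u \<in> singletons}
     = {concat (replicate i [2, 3 - 1]) @ e @ u | i e u. e \<in> optional_two \<and> u \<in> singletons}"
  (is "?L = ?R")
proof -
  have c: "concat (replicate i [2, 3 - 1]) = replicate (2 * i) (2::nat)" for i
    by (induction i) auto
  have a: "replicate i 2 @ u = concat (replicate (i div 2) [2, 3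
      - 1]) @ (if even i then [] else [2]) @ u"
    for i and u :: "nat list"
    unfolding c by (auto elim!: evenE oddE simp flip: replicate_append_same)
  show ?thesis
  proof (intro subset_antisym subsetI)
    fix x assume "x \<in> ?L"
    then obtain i u where x: "x = replicate i 2 @ u" and u: "u \<in> singletons"
      by blast
    show "x \<in> ?R"
      unfolding x a using u
      by (intro CollectI exI[of _ "i div 2"] exI[of _ "if even i then [] else [2]"] exI[of _ u])
        (auto simp: optional_two_def)
  next
    fix x assume "x \<in> ?R"
    then obtain i e u where x: "x = replicate (2 * i) 2 @ e @ u"
      and e: "e = [] \<or> e = [2]" and u: "u \<in> singletons"
      unfolding c optional_two_def by blast
    then have "x = replicate (2 * i + length e) 2 @ u"
      by (auto simp flip: replicate_append_same)
    then show "x \<in> ?L"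
      using u by blast
  qed
qed

lemma critical_weights_odd:
  assumes "odd w" "w \<ge> 2"
  shows "critical_weights w
    = {concat (replicate i [2, w - 1]) @ e @ u | i e u. e \<in> optional_two \<and> u \<in> singletons}"
  using assms critical_weights_3 by (auto simp: critical_weights_def)

text \<open>An even \<open>k\<close> in an oversized pair cannot be \<open>w\<close>, as
  \<open>w\<close> is odd, so only \<open>j = 2\<close> with \<open>k = w - 1\<close>
  remains.\<close>

lemma crit_iff_critical_weights_odd:
  assumes w: "odd w" "w \<ge> 2" and "word w g"
  shows "crit w g \<longleftrightarrow> g \<in> critical_weights w"
proof
  assume "crit w g"
  then have "\<exists>i e u. e \<in> optional_two \<and> u \<in> singletons \<and> g
      = concat (replicate i [2, w - 1]) @ e @ u"
    using \<open>word w g\<close>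
  proof (induction g rule: word_induct)
    case 1
    then show ?case
      by (intro exI[of _ 0] exI[of _ "[]"]) (auto simp: optional_two_def singletons_def)
  next
    case (2 j)
    then have "j = 1 \<or> j = 2" by auto
    then show ?case
      using singletons_Cons[of "[]"]
      by (intro exI[of _ 0] exI[of _ "if j = 2 then [2] else []"] exI[of _ "if j
        = 2 then [] else [1]"])
        (auto simp: optional_two_def singletons_def)
  next
    case (3 j k t)
    then have j: "j = 1 \<or> j = 2" by auto
    show ?case
    proof (cases "even k")
      case True
      with 3 obtain i e u where t: "e \<in> optional_two" "u \<in> singletons"
        "t = concat (replicate i [2, w - 1]) @ e @ u"
        by auto
      have "k \<noteq> w" using True w by auto
      then have "j = 2" "k = w - 1"
        using 3(3,4) j True w by (auto simp: le_less)
      with t show ?thesis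
        by (intro exI[of _ "Suc i"] exI[of _ e] exI[of _ u]) auto
    next
      case False
      with 3 obtain i e u where t: "e \<in> optional_two" "u \<in> singletons"
        "k # t = concat (replicate i [2, w - 1]) @ e @ u"
        by auto
      \<comment> \<open>A pair or the optional block would put 2 at the front, but \<open>k\<close>
        is odd.\<close>
      with False have "i = 0" "e = []"
        by (cases i; auto simp: optional_two_def)+
      with t have u: "k # t = u" by simp
      with t singletons_hd[of u] have "k = 1" by auto
      then show ?thesis
        using j t(2) u singletons_Cons[of u]
        by (intro exI[of _ 0] exI[of _ "if j = 2 then [2] else []"] exI[of _ "if j
          = 2 then u else 1 # u"])
         (auto simp: optional_two_def)
    qed
  qed
  then show "g \<in> critical_weights w"
    unfolding critical_weights_odd[OF w] by blast
next
  assume "g \<in> critical_weights w"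
  then obtain i e u where e: "e \<in> optional_two" and u: "u \<in> singletons"
    and g: "g = concat (replicate i [2, w - 1]) @ e @ u"
    unfolding critical_weights_odd[OF w] by blast
  have "crit w (concat (replicate i [2, w - 1]) @ e @ u)"
    using w crit_optional_two[OF e crit_singletons[OF u] singletons_hd[OF u]] by (induction i) auto
  then show "crit w g"
    unfolding g .
qed

lemma crit_even_piece:
  assumes "even w" "b \<in> even_pieces w" "crit w g"
  shows "crit w (b @ g)"
proof -
  have "crit w (e @ u @ [1, w] @ g)" if e: "e \<in> optional_two" and us: "u \<in> singletons" for e u
  proof -
    obtain m where u: "u = replicate m 1"
      using us by (auto simp: singletons_def)
    have "crit w (replicate m 1 @ 1 # w # g) \<and> hd (replicate m 1 @ 1 # w # g) = 1"
      by (induction m) (use assms in \<open>auto intro!: crit_Cons_odd\<close>)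
    then show ?thesis
      using crit_optional_two[OF e] unfolding u by auto
  qed
  then show ?thesis
    using assms unfolding even_pieces_def by auto
qed

lemma even_pieces_hd: "b \<in> even_pieces w \<Longrightarrow> b \<noteq> [] \<and> (hd b = 1 \<or> hd b = 2)"
  using singletons_hd by (fastforce simp: even_pieces_def optional_two_def hd_append)

lemma even_piecesI:
  "e \<in> optional_two \<Longrightarrow> u \<in> singletons \<Longrightarrow> e @ u @ [1, w] \<in> even_pieces w"
  unfolding even_pieces_def by blast

text \<open>A piece starting with 1 has no optional block yet, so a preceding 2 becomes this block
  and a preceding 1 joins the singletons.\<close>

lemma even_pieces_Cons:
  assumes "b \<in> even_pieces w" "hd b = 1" "j = 1 \<or> j = 2"
  shows "j # b \<in> even_pieces w"
proof -
  obtain u where u: "u \<in> singletons" "b = u @ [1, w]"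
    using assms by (auto simp: even_pieces_def optional_two_def)
  have "1 # u @ [1, w] \<in> even_pieces w"
    using even_piecesI[of "[]" "1 # u" w] u singletons_Cons[of u] by (simp add: optional_two_def)
  moreover have "2 # u @ [1, w] \<in> even_pieces w"
    using even_piecesI[of "[2]" u w] u by (simp add: optional_two_def)
  ultimately show ?thesis
    using assms(3) u by auto
qed

text \<open>For even \<open>w\<close> an oversized pair must have \<open>k = w\<close>, since
  \<open>k \<le> w - 2\<close> would allow the merge. A block followed by an odd one is absorbed by
  the next piece or, if there is none, by the final optional block and singletons.\<close>

lemma crit_iff_critical_weights_even:
  assumes w: "even w" "w > 2" and "word w g"
  shows "crit w g \<longleftrightarrow> g \<in> critical_weights w"
proof -
  let ?C = "\<lambda>g. \<exists>bs e u. set bs \<subseteq> even_pieces w \<and> e \<in> optional_two \<and> u \<in> singletons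
    \<and> g = concat bs @ e @ u"
  have "?C g" if "crit w g"
    using that \<open>word w g\<close>
  proof (induction g rule: word_induct)
    case 1
    then show ?case
      by (intro exI[of _ "[]"]) (auto simp: optional_two_def singletons_def)
  next
    case (2 j)
    then have "j = 1 \<or> j = 2" by auto
    then show ?case
      using singletons_Cons[of "[]"]
      by (intro exI[of _ "[]"] exI[of _ "if j = 2 then [2] else []"] exI[of _ "if j
        = 2 then [] else [1]"])
        (auto simp: optional_two_def singletons_def)
  next
    case (3 j k t)
    then have j: "j = 1 \<or> j = 2" by auto
    show ?case
    proof (cases "even k")
      case True
      with 3 obtain bs e u where t: "set bs \<subseteq> even_pieces w" "e \<in> optional_two" "u \<in> singletons"
        "t = concat bs @ e @ u"
        by auto
      have "k = w"
      proof (rule ccontr)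
        assume "k \<noteq> w"
        with 3(4) True w(1) have "k + 2 \<le> w"
          by (auto elim!: evenE)
        with 3(3) True j show False by auto
      qed
      moreover have "[2, w] \<in> even_pieces w"
        by (simp add: even_pieces_def)
      moreover have "[1, w] \<in> even_pieces w"
        using even_piecesI[of "[]" "[]" w] by (simp add: optional_two_def singletons_def)
      ultimately have "[j, k] \<in> even_pieces w"
        using j by auto
      with t show ?thesis
        by (intro exI[of _ "[j, k] # bs"] exI[of _ e] exI[of _ u]) auto
    next
      case False
      with 3 obtain bs e u where t: "set bs \<subseteq> even_pieces w" "e \<in> optional_two" "u \<in> singletons"
        "k # t = concat bs @ e @ u"
        by auto
      show ?thesis
      proof (cases bs)
        case Nil
        with t False have "e = []" and u: "k # t = u"
          by (auto simp: optional_two_def)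
        with t singletons_hd[of u] have "k = 1" by auto
        then show ?thesis
          using j t(3) u singletons_Cons[of u]
          by (intro exI[of _ "[]"] exI[of _ "if j = 2 then [2] else []"]
              exI[of _ "if j = 2 then u else 1 # u"]) (auto simp: optional_two_def)
      next
        case (Cons b bs')
        with t(1) even_pieces_hd[of b w] have "b \<noteq> []" "hd b = 1 \<or> hd b = 2"
          by auto
        moreover from this(1) t(4) Cons have "hd b = k"
          by (metis append_is_Nil_conv concat.simps(2) hd_append2 list.sel(1))
        ultimately have "j # b \<in> even_pieces w"
          using False even_pieces_Cons[of b w j] t(1) Cons j by auto
        with t Cons show ?thesis
          by (intro exI[of _ "(j # b) # bs'"] exI[of _ e] exI[of _ u]) auto
      qed
    qed
  qed
  moreover have "crit w g" if "?C g"
  proof -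
    from that obtain bs e u where bs: "set bs \<subseteq> even_pieces w" and e: "e \<in> optional_two"
      and u: "u \<in> singletons" and g: "g = concat bs @ e @ u"
      by blast
    have "crit w (concat bs @ e @ u)"
      using bs crit_optional_two[OF e crit_singletons[OF u] singletons_hd[OF u]] w(1)
      by (induction bs) (auto intro: crit_even_piece)
    then show ?thesis
      unfolding g .
  qed
  moreover have "g \<in> critical_weights w \<longleftrightarrow> ?C g"
    using w unfolding critical_weights_def by auto
  ultimately show ?thesis
    by blast
qed

text \<open>An even block has weight 2 here and already fills the width, so no merge fits.\<close>

lemma crit_2: "word 2 g \<Longrightarrow> crit 2 g"
  by (induction g rule: word_induct) auto

lemma crit_iff_critical_weights:
  assumes "w \<ge> 2" "word w g"
  shows "crit w g \<longleftrightarrow> g \<in> critical_weights w"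
proof -
  consider "w = 2" | "w > 2" "even w" | "odd w"
    using assms by fastforce
  then show ?thesis
  proof cases
    case 1
    with assms crit_2 show ?thesis
      by (auto simp: critical_weights_def)
  qed (use assms crit_iff_critical_weights_even crit_iff_critical_weights_odd in auto)
qed

section \<open>Incidence numbers of the quotient complex\<close>

definition list_sign :: "'a list \<Rightarrow> 'a list \<Rightarrow> int" where
  "list_sign g l = sign (THE p. p permutes set g \<and> map p g = l)"

lemma list_sign_eq:
  assumes "p permutes set g" "map p g = l"
  shows "list_sign g l = sign p"
proof -
  have "q = p" if "q permutes set g \<and> map q g = l" for q
  proof
    fix x
    show "q x = p x"
      using that assms by (cases "x \<in> set g") (auto simp: permutes_not_in)
  qed
  with assms have "(THE p. p permutes set g \<and> map p g = l) = p"
    by (intro the_equality conjI)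
  then show ?thesis
    by (simp add: list_sign_def)
qed

lemma ex_permutes_map:
  assumes "distinct g" "distinct l" "set g = set l"
  shows "\<exists>p. p permutes set g \<and> map p g = l"
proof -
  have len: "length g = length l"
    using assms distinct_card by metis
  define f where "f = (\<lambda>x. the (map_of (zip g l) x))"
  have fg: "map f g = l"
  proof (rule nth_equalityI)
    fix i assume "i < length (map f g)"
    then show "map f g ! i = l ! i"
      using assms len by (simp add: f_def map_of_zip_nth)
  qed (simp add: len)
  then have "f ` set g = set l"
    by (metis set_map)
  then have "bij_betw f (set g) (set g)"
    using assms by (simp add: bij_betw_def finite_surj_inj)
  then have "(\<lambda>x. if x \<in> set g then f x else x) permutes set g"
    by (intro bij_imp_permutes) (auto simp: bij_betw_def inj_on_def)
  then show ?thesis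
    using fg by (intro exI[of _ "\<lambda>x. if x \<in> set g then f x else x"]) (auto intro: map_cong)
qed

text \<open>The cycle that moves \<open>x\<close> past \<open>a\<close>, composed of one
  transposition for each label of \<open>a\<close>.\<close>

lemma move_head:
  "distinct (x # a @ b) \<Longrightarrow>
     \<exists>c. c permutes set (x # a @ b) \<and> map c (x # a @ b) = a @ x # b \<and> sign c = (- 1) ^ length a"
proof (induction a)
  case Nil
  then show ?case
    by (intro exI[of _ id] conjI permutes_id) simp_all
next
  case (Cons y a)
  then obtain c where c: "c permutes set (x # a @ b)" "map c (x # a @ b) = a @ x # b"
    "sign c = (- 1) ^ length a"
    by auto
  \<comment> \<open>This first exchanges \<open>x\<close> and \<open>y\<close>; then
    \<open>c\<close> moves \<open>x\<close> past the rest and fixes \<open>y\<close>.\<close>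
  let ?d = "transpose x y"
  have d: "?d permutes set (x # (y # a) @ b)"
    by (rule permutes_swap_id) auto
  have c': "c permutes set (x # (y # a) @ b)"
    using c(1) by (rule permutes_subset) auto
  have "map ?d (x # (y # a) @ b) = y # x # a @ b"
    using Cons.prems by (auto simp: transpose_def intro!: map_idI)
  moreover have "c y = y"
    using c(1) Cons.prems by (intro permutes_not_in[of c]) auto
  ultimately have map: "map (c \<circ> ?d) (x # (y # a) @ b) = (y # a) @ x # b"
    using c(2) by (metis list.map_comp list.simps(9) append_Cons)
  have "sign (c \<circ> ?d) = - ((- 1) ^ length a)"
    using c(3) Cons.prems c(1)
    by (subst sign_compose) (auto simp: sign_swap_id permutation_swap_id intro:
      permutes_imp_permutation[rotated])
  then have sign: "sign (c \<circ> ?d) = (- 1) ^ length (y # a)"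
    by simp
  show ?case
    by (intro exI[of _ "c \<circ> ?d"] conjI permutes_compose[OF d c'] map sign)
qed

text \<open>The recursion for Gaussian binomial coefficients: inserting the first label \<open>x\<close> after \<open>a\<close>
  costs \<open>length a\<close> transpositions.\<close>

lemma list_sign_insert:
  assumes "distinct (x # g)" "distinct (a @ b)" "set g = set (a @ b)"
  shows "list_sign (x # g) (a @ x # b) = (- 1) ^ length a * list_sign g (a @ b)"
proof -
  obtain p where p: "p permutes set g" "map p g = a @ b"
    using ex_permutes_map[of g "a @ b"] assms by auto
  have dist: "distinct (x # a @ b)"
    using assms by auto
  from move_head[OF dist] obtain c where c: "c permutes set (x # a @ b)"
      "map c (x # a @ b) = a @ x # b"
    "sign c = (- 1) ^ length a"
    by (elim exE conjE)
  have p': "p permutes set (x # g)"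
    using p(1) by (rule permutes_subset) auto
  have c': "c permutes set (x # g)"
    using c(1) assms(3) by auto
  have "p x = x"
    using p(1) assms by (intro permutes_not_in[of p]) auto
  then have "map (c \<circ> p) (x # g) = a @ x # b"
    using c(2) p(2) by (metis list.map_comp list.simps(9))
  then have "list_sign (x # g) (a @ x # b) = sign (c \<circ> p)"
    using permutes_compose[OF p' c'] by (intro list_sign_eq)
  also have "\<dots> = sign c * sign p"
    using p' c' by (intro sign_compose) (auto intro: permutes_imp_permutation[rotated])
  finally show ?thesis
    using c(3) list_sign_eq[OF p] by simp
qed

definition splits :: "'a list \<Rightarrow> nat \<Rightarrow> ('a list \<times> 'a list) set" where
  "splits g i = {(a, b). g \<in> shuffles a b \<and> length a = i}"

lemma splits_Nil: "splits [] i = (if i = 0 then {([], [])} else {})"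
  by (auto simp: splits_def)

lemma splits_Cons: "splits (x # g) i
    = (if i = 0 then {} else (\<lambda>(a, b). (x # a, b)) ` splits g (i - 1))
      \<union> (\<lambda>(a, b). (a, x # b)) ` splits g i"
proof -
  have "(a, b) \<in> splits (x # g) i \<longleftrightarrow> (a, b) \<in> (if i
      = 0 then {} else (\<lambda>(a, b). (x # a, b)) ` splits g (i - 1))
      \<union> (\<lambda>(a, b). (a, x # b)) ` splits g i" for a b
    by (cases a; cases b) (auto simp: splits_def Cons_in_shuffles_iff image_iff)
  then show ?thesis
    unfolding set_eq_iff split_paired_All by blast
qed

lemma shuffles_distinct_append:
  assumes "g \<in> shuffles a b" "distinct g"
  shows "distinct (a @ b) \<and> set g = set (a @ b)"
proof -
  have "mset g = mset (a @ b)"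
    using mset_shuffles[OF assms(1)] by simp
  then show ?thesis
    using assms(2) by (metis mset_eq_imp_distinct_iff mset_eq_setD)
qed

lemma finite_splits: "finite (splits g i)"
  by (induction g arbitrary: i) (auto simp: splits_Nil splits_Cons)

lemma splits_length: "(a, b) \<in> splits g i \<Longrightarrow> length a = i \<and> length b = length g - i \<and> i \<le> length g"
  by (auto simp: splits_def dest: length_shuffles)

text \<open>Putting the first label into \<open>a\<close> costs nothing, and putting it into
  \<open>b\<close> costs \<open>length a\<close> transpositions, so the signed count obeys the
  q-Pascal rule at \<open>q = -1\<close>.\<close>

lemma sum_splits:
  assumes "distinct g" "i \<le> length g"
  shows "(\<Sum>(a, b)\<in>splits g i. list_sign g (a @ b)) = qbin i (length g - i)"
  using assms
proof (induction g arbitrary: i)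
  case Nil
  have "list_sign ([] :: 'a list) [] = sign (id :: 'a \<Rightarrow> 'a)"
    by (rule list_sign_eq) (auto simp: permutes_id)
  with Nil show ?case
    by (simp add: splits_Nil)
next
  case (Cons x g)
  have ab: "distinct (a @ b) \<and> set g = set (a @ b)" if "(a, b) \<in> splits g i" for a b i
    using that Cons.prems(1) shuffles_distinct_append[of g a b] by (simp add: splits_def)
  have 2: "(\<Sum>(a, b)\<in>(\<lambda>(a, b). (a, x # b)) ` splits g i. list_sign (x # g) (a @ b))
      = (- 1) ^ i * (\<Sum>(a, b)\<in>splits g i. list_sign g (a @ b))" for i
  proof (subst sum.reindex, goal_cases)
    case 2
    have "list_sign (x # g) (a @ x # b) = (- 1) ^ i * list_sign g (a @ b)"
        if "(a, b) \<in> splits g i" for a b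
      using list_sign_insert[of x g a b] ab[OF that] splits_length[OF that] Cons.prems by auto
    then show ?case
      by (auto simp: sum_distrib_left intro!: sum.cong)
  qed (auto simp: inj_on_def)
  have 1: "(\<Sum>(a, b)\<in>(\<lambda>(a, b). (x # a, b)) ` splits g i. list_sign (x # g) (a @ b))
      = (\<Sum>(a, b)\<in>splits g i. list_sign g (a @ b))" for i
  proof (subst sum.reindex, goal_cases)
    case 2
    have "list_sign (x # g) (x # a @ b) = list_sign g (a @ b)" if "(a, b) \<in> splits g i" for a b
      using list_sign_insert[of x g "[]" "a @ b"] ab[OF that] Cons.prems by auto
    then show ?case
      by (auto intro!: sum.cong)
  qed (auto simp: inj_on_def)
  show ?case
  proof (cases i)
    case 0
    with Cons 2[of 0] show ?thesis
      by (simp add: splits_Cons)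
  next
    case (Suc m)
    have "x \<notin> set a" if "(a, b) \<in> splits g i" for a b
      using ab[OF that] Cons.prems by auto
    then have "(\<lambda>(a, b). (x # a, b)) ` splits g m \<inter> (\<lambda>(a, b). (a, x # b)) ` splits g i = {}"
      by fastforce
    then have "(\<Sum>(a, b)\<in>splits (x # g) i. list_sign (x # g) (a @ b))
        = (\<Sum>(a, b)\<in>splits g m. list_sign g (a @ b))
          + (- 1) ^ i * (\<Sum>(a, b)\<in>splits g i. list_sign g (a @ b))"
      using Suc by (simp add: splits_Cons sum.union_disjoint finite_splits 1 2)
    also have "\<dots> = qbin i (length (x # g) - i)"
    \<comment> \<open>In this case all labels belong to the first part, and the second summand is
      empty.\<close>
    proof (cases "m = length g")
      case True
      then have "splits g i = {}"
        using splits_length Suc by fastforce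
      then show ?thesis
        using True Suc Cons by simp
    next
      case False
      then have "length g - m = Suc (length g - i)"
        using Suc Cons.prems by auto
      then show ?thesis
        using False Suc Cons qbin_Suc_Suc[of m "length g - i"] by simp
    qed
    finally show ?thesis .
  qed
qed

lemma sum_block_incidence:
  assumes "distinct g" "0 < i" "i < length g"
  shows "of_int (\<Sum>(a, b)\<in>splits g i. block_incidence g a b) = split_coeff i (length g - i)"
proof -
  have "block_incidence g a b = (- 1) ^ i * list_sign g (a @ b)" if "(a, b) \<in> splits g i" for a b
    using that splits_length[OF that] assms
    by (auto simp: block_incidence_def list_sign_def splits_def)
  then have "(\<Sum>(a, b)\<in>splits g i. block_incidence g a b)
      = (- 1) ^ i * (\<Sum>(a, b)\<in>splits g i. list_sign g (a @ b))"
    by (auto simp: sum_distrib_left intro!: sum.cong)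
  then show ?thesis
    using assms by (simp add: sum_splits split_coeff_def)
qed

section \<open>Orbits as words\<close>

text \<open>For \<open>A = {1..n}\<close> these are the orbits under relabelling
  (\<open>symb_orbit_eq\<close>). Arbitrary label sets are needed for the induction over the
  blocks.\<close>

definition symbols :: "nat set \<Rightarrow> nat list \<Rightarrow> symb set" where
  "symbols A l = {f. distinct (concat f) \<and> set (concat f) = A \<and> map length f = l}"

lemma finite_symbols:
  assumes "finite A"
  shows "finite (symbols A l)"
proof (rule finite_subset)
  let ?B = "{b. set b \<subseteq> A \<and> length b \<le> sum_list l}"
  show "symbols A l \<subseteq> {f. set f \<subseteq> ?B \<and> length f = length l}"
    by (auto simp: symbols_def member_le_sum_list)
  show "finite {f. set f \<subseteq> ?B \<and> length f = length l}"
    using assms by (intro finite_lists_length_eq finite_lists_length_le)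
qed

text \<open>The projected boundary depends only on block sizes: the Leibniz recursions of
  \<open>cel_incidence\<close> and \<open>bd_eval\<close> match, the first summand by counting
  shuffles and the second by induction on the remaining labels.\<close>

lemma sum_cel_incidence:
  assumes "distinct (concat s)"
  shows "of_int (\<Sum>f\<in>symbols (set (concat s)) l. cel_incidence s f)
    = bd_eval (\<lambda>u. if u = l then 1 else 0) (map length s)"
  using assms
proof (induction s arbitrary: l)
  case (Cons g s)
  let ?S = "symbols (set (concat (g # s))) l"
  have fin: "finite ?S"
    by (rule finite_symbols) simp
  have 1: "of_int (\<Sum>f\<in>?S. case f of a # b # t \<Rightarrow> if t = s then block_incidence g a b else 0 | _ \<Rightarrow> 0)
    = (\<Sum>i = 1..<length g. split_coeff i (length g - i) * (if i # (length g - i) # map length s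
        = l then 1 else 0))"
    (is "of_int (sum ?F ?S) = _")
  \<comment> \<open>The word \<open>l\<close> admits at most one size \<open>i\<close> for the first
    part.\<close>
  proof (cases "\<exists>i\<in>{1..<length g}. l = i # (length g - i) # map length s")
    case True
    then obtain i where i: "i \<in> {1..<length g}" and l: "l = i # (length g - i) # map length s"
      by blast
    have "sum ?F ?S = sum ?F ((\<lambda>(a, b). a # b # s) ` splits g i)"
    proof (rule sum.mono_neutral_right[OF fin])
      have "distinct (a @ b) \<and> set g = set (a @ b)" if "(a, b) \<in> splits g i" for a b
        using that Cons.prems(1) shuffles_distinct_append[of g a b] by (simp add: splits_def)
      then show "(\<lambda>(a, b). a # b # s) ` splits g i \<subseteq> ?S"
        using Cons.prems splits_length[of _ _ g i] by (fastforce simp: symbols_def l)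
      show "\<forall>f\<in>?S - (\<lambda>(a, b). a # b # s) ` splits g i. ?F f = 0"
        by (auto simp: symbols_def l block_incidence_def splits_def image_iff split: list.splits)
    qed
    also have "\<dots> = (\<Sum>(a, b)\<in>splits g i. block_incidence g a b)"
      by (subst sum.reindex) (auto simp: inj_on_def intro!: sum.cong)
    finally have "of_int (sum ?F ?S) = split_coeff i (length g - i)"
      using sum_block_incidence[of g i] Cons.prems i by simp
    also have "\<dots> = (\<Sum>j = 1..<length g. if j = i then split_coeff i (length g - i) else 0)"
      using i by simp
    also have "\<dots> = (\<Sum>i = 1..<length g. split_coeff i (length g - i) * (if i # (length g
        - i) # map length s = l then 1 else 0))"
      by (intro sum.cong) (auto simp: l)
    finally show ?thesis .
  next
    case False
    have "?F f = 0" if "f \<in> ?S" for f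
    proof (rule ccontr)
      assume "?F f \<noteq> 0"
      then obtain a b where f: "f = a # b # s" and ab: "a \<noteq> []" "b \<noteq> []" "g \<in> shuffles a b"
        by (auto simp: block_incidence_def split: list.splits if_splits)
      then have "length a \<in> {1..<length g}" "length b = length g - length a"
        by (auto dest!: length_shuffles simp: Suc_le_eq)
      with that f False show False
        by (auto simp: symbols_def)
    qed
    moreover have "(\<Sum>i = 1..<length g. split_coeff i (length g - i) * (if i # (length g
        - i) # map length s = l then 1 else 0)) = 0"
      using False by (intro sum.neutral) auto
    ultimately show ?thesis
      by simp
  qed
  have 2: "of_int (\<Sum>f\<in>?S. case f of h # t \<Rightarrow> if h
      = g then (- 1) ^ (length g - 1) * cel_incidence s t else 0
              | _ \<Rightarrow> 0) = (- 1) ^ (length g - 1) * bd_eval (\<lambda>u.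
                if length g # u = l then 1 else 0) (map length s)"
    (is "of_int (sum ?F ?S) = _")
  proof (cases "\<exists>l'. l = length g # l'")
    case True
    then obtain l' where l: "l = length g # l'" ..
    have "sum ?F ?S = sum ?F ((#) g ` symbols (set (concat s)) l')"
    proof (rule sum.mono_neutral_right[OF fin])
      have "g # t \<in> ?S" if "t \<in> symbols (set (concat s)) l'" for t
      proof -
        have t: "set (concat t) = set (concat s)" "distinct (concat t)" "map length t = l'"
          using that by (simp_all add: symbols_def)
        then have "distinct (concat (g # t))" "set (concat (g # t)) = set (concat (g # s))"
          using Cons.prems unfolding concat.simps distinct_append set_append by blast+
        then show ?thesis
          using t(3) by (simp add: symbols_def l)
      qed
      then show "(#) g ` symbols (set (concat s)) l' \<subseteq> ?S"
        by blast
      have "t \<in> symbols (set (concat s)) l'" if "g # t \<in> ?S" for t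
      proof -
        have "set (concat (g # t)) = set (concat (g # s))" "distinct (concat (g # t))"
            "map length t = l'"
          using that by (simp_all add: symbols_def l)
        moreover from this have "set (concat t) = set (concat s)"
          using Cons.prems unfolding concat.simps distinct_append set_append by blast
        ultimately show ?thesis
          by (simp add: symbols_def)
      qed
      then show "\<forall>f\<in>?S - (#) g ` symbols (set (concat s)) l'. ?F f = 0"
        by (auto split: list.splits)
    qed
    also have "\<dots> = (- 1) ^ (length g - 1) * (\<Sum>f\<in>symbols (set (concat s)) l'. cel_incidence s f)"
      by (subst sum.reindex) (auto simp: sum_distrib_left)
    finally show ?thesis
      using Cons by (simp add: l)
  next
    case False
    then have "?F f = 0" if "f \<in> ?S" for f
      using that by (auto simp: symbols_def split: list.splits)
    moreover have "bd_eval (\<lambda>u. if length g # u = l then 1 else 0) (map length s) = 0"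
      by (rule bd_eval_zero) (use False in auto)
    ultimately show ?thesis
      by simp
  qed
  show ?case
    unfolding cel_incidence.simps sum.distrib of_int_add 1 2 by simp
qed simp

text \<open>Relabelling is transitive on symbols with equal block sizes: a permutation matching the
  concatenated labels also matches the blocks.\<close>

lemma symb_orbit_eq:
  assumes "s \<in> cel n w"
  shows "symb_orbit n s = symbols {1..n} (map length s)"
proof (intro subset_antisym subsetI)
  fix t assume "t \<in> symb_orbit n s"
  then obtain p where p: "p permutes {1..n}" and t: "t = map (map p) s"
    by (auto simp: symb_orbit_def relabel_def)
  have "concat t = map p (concat s)"
    by (simp add: t map_concat)
  moreover from this have "set (concat t) = {1..n}"
    using assms permutes_image[OF p] by (simp add: cel_def)
  moreover have "inj_on p A" for A
    using permutes_inj[OF p] by (rule inj_on_subset) simp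
  ultimately have "distinct (concat t)" "set (concat t) = {1..n}"
    using assms by (auto simp: cel_def distinct_map)
  moreover have "map length t = map length s"
    by (simp add: t)
  ultimately show "t \<in> symbols {1..n} (map length s)"
    by (simp only: symbols_def mem_Collect_eq simp_thms)
next
  fix t assume t: "t \<in> symbols {1..n} (map length s)"
  then obtain p where p: "p permutes {1..n}" "map p (concat s) = concat t"
    using ex_permutes_map[of "concat s" "concat t"] assms by (auto simp: symbols_def cel_def)
  have m: "map length s = map length t"
    using t by (simp add: symbols_def)
  then have len: "length s = length t"
    by (rule map_eq_imp_length_eq)
  have "length (s ! i) = length (t ! i)" if "i < length s" for i
    using m that len by (metis nth_map)
  then have "t = relabel p s"
    unfolding relabel_def using p(2) len
    by (intro concat_injective) (auto simp: map_concat set_zip)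
  then show "t \<in> symb_orbit n s"
    using p by (auto simp: symb_orbit_def)
qed

text \<open>The choice of representative is harmless, because relabelling preserves block
  sizes.\<close>

definition shape :: "ucell \<Rightarrow> nat list" where
  "shape F = map length (SOME s. s \<in> F)"

lemma some_symb_orbit:
  assumes "s \<in> cel n w"
  shows "(SOME t. t \<in> symb_orbit n s) \<in> symbols {1..n} (map length s)"
  unfolding symb_orbit_eq[OF assms]
  by (rule someI[of _ s]) (use assms in \<open>auto simp: symbols_def cel_def\<close>)

lemma shape_symb_orbit:
  assumes "s \<in> cel n w"
  shows "shape (symb_orbit n s) = map length s"
  using some_symb_orbit[OF assms] by (simp add: shape_def symbols_def)

lemma map_length_cel:
  assumes "s \<in> cel n w"
  shows "map length s \<in> words n w" "cel_dim s = n - length s"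
proof -
  have "length (concat s) = n"
    using assms distinct_card[of "concat s"] by (simp add: cel_def)
  then show "map length s \<in> words n w" "cel_dim s = n - length s"
    using assms by (auto simp: cel_def cel_dim_def words_def length_concat)
qed

lemma bij_betw_shape: "bij_betw shape (ucel n w) (words n w)"
proof (rule bij_betwI')
  fix F G assume "F \<in> ucel n w" "G \<in> ucel n w"
  then obtain s t where "s \<in> cel n w" "F = symb_orbit n s" "t \<in> cel n w" "G = symb_orbit n t"
    by (auto simp: ucel_def)
  moreover from this have "shape F = map length s" "shape G = map length t"
    by (simp_all add: shape_symb_orbit)
  ultimately show "shape F = shape G \<longleftrightarrow> F = G"
    by (metis symb_orbit_eq)
next
  fix F assume "F \<in> ucel n w"
  then obtain s where "s \<in> cel n w" "F = symb_orbit n s"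
    by (auto simp: ucel_def)
  then show "shape F \<in> words n w"
    using map_length_cel shape_symb_orbit by metis
next
  fix u assume u: "u \<in> words n w"
  have "\<exists>s. concat s = xs \<and> map length s = u" if "length xs = sum_list u" for xs :: "nat list"
    using that
  proof (induction u arbitrary: xs)
    case (Cons j u)
    then obtain s where "concat s = drop j xs" "map length s = u"
      by (metis add_diff_cancel_left' length_drop sum_list.Cons)
    with Cons(2) show ?case
      by (intro exI[of _ "take j xs # s"]) auto
  qed auto
  \<comment> \<open>Cutting the increasing list of labels into blocks of the prescribed sizes gives
    a representative.\<close>
  from this[of "[1..<Suc n]"] u obtain s where s: "concat s = [1..<Suc n]" "map length s = u"
    by (auto simp: words_def simp del: upt_Suc)
  have "b \<noteq> [] \<and> length b \<le> w" if "b \<in> set s" for b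
    using u that unfolding s(2)[symmetric] by (auto simp: words_def)
  moreover have "distinct (concat s)" "set (concat s) = {1..n}"
    unfolding s(1) by auto
  ultimately have "s \<in> cel n w"
    by (simp add: cel_def)
  then show "\<exists>F\<in>ucel n w. u = shape F"
    using s u by (intro bexI[of _ "symb_orbit n s"]) (auto simp: shape_symb_orbit ucel_def)
qed

lemma ucel_cells_iff: "F \<in> ucel_cells n w k \<longleftrightarrow> F \<in> ucel n w \<and> n - length (shape F) = k"
proof
  assume "F \<in> ucel_cells n w k"
  then obtain s where s: "s \<in> cel n w" "cel_dim s = k" "F = symb_orbit n s"
    by (auto simp: ucel_cells_def)
  then have "shape F = map length s"
    using shape_symb_orbit by metis
  then show "F \<in> ucel n w \<and> n - length (shape F) = k"
    using s map_length_cel(2)[OF s(1)] by (auto simp: ucel_def)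
next
  assume F: "F \<in> ucel n w \<and> n - length (shape F) = k"
  then obtain s where s: "s \<in> cel n w" "F = symb_orbit n s"
    by (auto simp: ucel_def)
  then have "shape F = map length s"
    using shape_symb_orbit by metis
  then show "F \<in> ucel_cells n w k"
    using s F map_length_cel(2)[OF s(1)] by (auto simp: ucel_cells_def)
qed

lemma ucel_incidence_eq:
  assumes "F \<in> ucel n w" "G \<in> ucel n w"
  shows "of_int (ucel_incidence G F) = bd_eval (delta (shape F)) (shape G)"
proof -
  obtain s t where s: "s \<in> cel n w" "F = symb_orbit n s" and t: "t \<in> cel n w" "G = symb_orbit n t"
    using assms by (auto simp: ucel_def)
  let ?g = "SOME g. g \<in> G"
  have "?g \<in> symbols {1..n} (map length t)"
    using some_symb_orbit t by auto
  then have "distinct (concat ?g)" "set (concat ?g) = {1..n}" "map length ?g = shape G"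
    by (auto simp: symbols_def shape_def)
  then show ?thesis
    using sum_cel_incidence[of ?g "shape F"] shape_symb_orbit[OF s(1)]
    by (simp add: ucel_incidence_def s(2) symb_orbit_eq[OF s(1)])
qed

section \<open>The matching and the homology\<close>

text \<open>At a minimal index \<open>m\<close> only \<open>e m\<close> can be nonzero, which fixes
  its coefficient; subtracting this multiple reduces to \<open>C - {m}\<close>.\<close>

lemma triangular_span:
  fixes e :: "'c \<Rightarrow> 'c \<Rightarrow> rat"
  assumes "finite C" "\<And>F. F \<in> C \<Longrightarrow> e F F \<noteq> 0"
    and "\<And>F G. F \<in> C \<Longrightarrow> G \<in> C \<Longrightarrow> F \<noteq> G \<Longrightarrow> e F G \<noteq> 0 \<Longrightarrow> R F G"
    and R: "transp R" "asymp R"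
  shows "\<exists>\<alpha>. \<forall>G\<in>C. x G = (\<Sum>F\<in>C. \<alpha> F * e F G)"
  using assms(1-3)
proof (induction "card C" arbitrary: C x)
  case (Suc k)
  then have "C \<noteq> {}" by auto
  then obtain m where m: "m \<in> C" "\<And>G. G \<in> C \<Longrightarrow> G \<noteq> m \<Longrightarrow> \<not> R G m"
    using Finite_Set.bex_min_element[OF Suc(3)] R
    by (metis asymp_on_subset transp_on_subset subset_UNIV)
  let ?c = "x m / e m m"
  obtain \<alpha> where \<alpha>: "\<forall>G\<in>C - {m}. x G - ?c * e m G = (\<Sum>F\<in>C - {m}. \<alpha> F * e F G)"
    using Suc(1)[of "C - {m}" "\<lambda>G. x G - ?c * e m G"] Suc(2-) m(1) by force
  have sum: "(\<Sum>F\<in>C. (\<alpha>(m := ?c)) F * e F G) = ?c * e m G + (\<Sum>F\<in>C - {m}. \<alpha> F * e F G)" for G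
    by (simp add: sum.remove[OF Suc(3) m(1)])
  have 0: "(\<Sum>F\<in>C - {m}. \<alpha> F * e F m) = 0"
    using m Suc(5) by (intro sum.neutral) fastforce
  have "x G = (\<Sum>F\<in>C. (\<alpha>(m := ?c)) F * e F G)" if "G \<in> C" for G
  proof (cases "G = m")
    case True
    then show ?thesis
      unfolding sum True 0 using Suc(4) m(1) by simp
  next
    case False
    then have "x G - ?c * e m G = (\<Sum>F\<in>C - {m}. \<alpha> F * e F G)"
      using that \<alpha> by blast
    then show ?thesis
      by (simp only: sum)
  qed
  then show ?case by blast
qed auto

text \<open>Evaluation at a minimal index with nonzero coefficient isolates that
  coefficient.\<close>

lemma triangular_independent:
  fixes e :: "'c \<Rightarrow> 'c \<Rightarrow> rat"
  assumes "finite C" "\<And>F. F \<in> C \<Longrightarrow> e F F \<noteq> 0"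
    and "\<And>F G. F \<in> C \<Longrightarrow> G \<in> C \<Longrightarrow> F \<noteq> G \<Longrightarrow> e F G \<noteq> 0 \<Longrightarrow> R F G"
    and R: "transp R" "asymp R"
    and sum: "\<And>G. G \<in> C \<Longrightarrow> (\<Sum>F\<in>C. \<alpha> F * e F G) = 0"
    and "F \<in> C"
  shows "\<alpha> F = 0"
proof (rule ccontr)
  assume "\<alpha> F \<noteq> 0"
  define C' where "C' = {F \<in> C. \<alpha> F \<noteq> 0}"
  have "finite C'" "C' \<noteq> {}"
    using \<open>finite C\<close> \<open>\<alpha> F \<noteq> 0\<close> \<open>F \<in> C\<close> by (auto simp: C'_def)
  then obtain m where m: "m \<in> C'" "\<And>G. G \<in> C' \<Longrightarrow> G \<noteq> m \<Longrightarrow> \<not> R G m"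
    using Finite_Set.bex_min_element[of C' R] R
    by (metis asymp_on_subset transp_on_subset subset_UNIV)
  have "m \<in> C" "\<alpha> m \<noteq> 0"
    using m by (auto simp: C'_def)
  have "(\<Sum>F\<in>C - {m}. \<alpha> F * e F m) = 0"
    using m assms(3) \<open>m \<in> C\<close> by (intro sum.neutral) (fastforce simp: C'_def)
  then have "\<alpha> m * e m m = 0"
    using sum[OF \<open>m \<in> C\<close>] by (simp add: sum.remove[OF \<open>finite C\<close> \<open>m \<in> C\<close>])
  then show False
    using \<open>m \<in> C\<close> \<open>\<alpha> m \<noteq> 0\<close> assms(2) by simp
qed

section \<open>The matching on cells and its acyclicity\<close>

definition cell_of :: "nat \<Rightarrow> nat \<Rightarrow> nat list \<Rightarrow> ucell" where
  "cell_of n w = inv_into (ucel n w) shape"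

lemma shape_in_words: "F \<in> ucel n w \<Longrightarrow> shape F \<in> words n w"
  using bij_betw_shape by (rule bij_betwE[rule_format])

lemma cell_of_in_ucel: "u \<in> words n w \<Longrightarrow> cell_of n w u \<in> ucel n w"
  and shape_cell_of: "u \<in> words n w \<Longrightarrow> shape (cell_of n w u) = u"
  using bij_betw_shape[of n w] unfolding cell_of_def bij_betw_def
  by (auto simp: inv_into_into f_inv_into_f)

lemma cell_of_shape: "F \<in> ucel n w \<Longrightarrow> cell_of n w (shape F) = F"
  using bij_betw_shape[of n w] unfolding cell_of_def bij_betw_def by simp

lemma finite_ucel: "finite (ucel n w)"
  using bij_betw_finite[OF bij_betw_shape] finite_words by blast

lemma finite_ucel_cells: "finite (ucel_cells n w k)"
  by (rule finite_subset[OF _ finite_ucel[of n w]]) (auto simp: ucel_cells_iff)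

lemma sum_ucel: "(\<Sum>F\<in>ucel n w. h (shape F)) = (\<Sum>u\<in>words n w. h u)"
  using bij_betw_shape by (rule sum.reindex_bij_betw)

lemma wordsD: "u \<in> words n w \<Longrightarrow> word w u" "u \<in> words n w \<Longrightarrow> sum_list u = n"
  and wordsI: "word w u \<Longrightarrow> sum_list u = n \<Longrightarrow> u \<in> words n w"
  by (simp_all add: words_def)

lemma src_words:
  assumes "g \<in> words n w" "src w g = Some f"
  shows "f \<in> words n w"
proof -
  note f = src_word[OF assms(2) wordsD(1)[OF assms(1)]]
  show ?thesis
    using f wordsD(2)[OF assms(1)] by (intro wordsI) simp_all
qed

lemma tgt_words:
  assumes "f \<in> words n w" "tgt w f = Some g"
  shows "g \<in> words n w"
proof -
  note g = tgt_src[OF assms(2) wordsD(1)[OF assms(1)]]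
  have "sum_list f = sum_list g"
    using src_word[of w g f] g by blast
  then show ?thesis
    using g wordsD(2)[OF assms(1)] by (intro wordsI) simp_all
qed

lemma word_shape: "F \<in> ucel n w \<Longrightarrow> word w (shape F)"
  using wordsD(1)[OF shape_in_words] .

definition cell_less :: "nat \<Rightarrow> ucell \<Rightarrow> ucell \<Rightarrow> bool" where
  "cell_less w F G \<longleftrightarrow> key_less w 0 (shape F) (shape G)"

lemma transp_cell_less: "transp (cell_less w)"
  unfolding cell_less_def by (rule transpI) (rule key_less_trans)

lemma asymp_cell_less: "asymp (cell_less w)"
  unfolding cell_less_def by (rule asympI) (metis key_less_trans key_less_irrefl)

definition matching :: "nat \<Rightarrow> nat \<Rightarrow> (ucell \<times> ucell) set" where
  "matching n w = {(F, G). F \<in> ucel n w \<and> G \<in> ucel n w \<and> src w (shape G) = Some (shape F)}"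

lemma src_length:
  assumes "g \<in> words n w" "src w g = Some f"
  shows "n - length g = Suc (n - length f)"
proof -
  have "length f = Suc (length g)"
    using src_word[OF assms(2) wordsD(1)[OF assms(1)]] by simp
  moreover have "length f \<le> n"
    using length_word_le[OF wordsD(1)] wordsD(2) src_words[OF assms] by metis
  ultimately show ?thesis by simp
qed

lemma matching_incidence:
  assumes "(F, G) \<in> matching n w"
  shows "ucel_incidence G F \<noteq> 0"
    and "F' \<in> ucel n w \<Longrightarrow> ucel_incidence G F' \<noteq> 0 \<Longrightarrow> F' \<noteq> F \<Longrightarrow> cell_less w F F'"
proof -
  have FG: "F \<in> ucel n w" "G \<in> ucel n w" "src w (shape G) = Some (shape F)" "word w (shape G)"
    using assms shape_in_words[of G n w] by (auto simp: matching_def words_def)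
  have "of_int (ucel_incidence G F) \<noteq> (0 :: rat)"
    unfolding ucel_incidence_eq[OF FG(1,2)] by (rule bd_eval_delta_lead(1)[OF FG(4,3)])
  then show "ucel_incidence G F \<noteq> 0"
    by simp
  assume F': "F' \<in> ucel n w" "ucel_incidence G F' \<noteq> 0" "F' \<noteq> F"
  then have "bd_eval (delta (shape F')) (shape G) \<noteq> 0"
    unfolding ucel_incidence_eq[OF F'(1) FG(2), symmetric] by simp
  moreover have "shape F' \<noteq> shape F"
    using F' FG cell_of_shape by metis
  ultimately show "cell_less w F F'"
    unfolding cell_less_def by (rule bd_eval_delta_lead(2)[OF FG(4,3)])
qed

text \<open>Partners are unique because \<open>src\<close> and \<open>tgt\<close> are mutually
  inverse partial functions, and \<open>not_src_tgt\<close> prevents a cell from being lower in one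
  pair and upper in another.\<close>

lemma discrete_vector_field_matching: "discrete_vector_field n w (matching n w)"
  unfolding discrete_vector_field_def
proof (intro conjI ballI impI)
  fix p assume p: "p \<in> matching n w"
  then obtain F G where FG: "p = (F, G)" "F \<in> ucel n w" "G \<in> ucel n w"
      "src w (shape G) = Some (shape F)"
    by (auto simp: matching_def)
  have "n - length (shape G) = Suc (n - length (shape F))"
    using FG shape_in_words by (intro src_length) auto
  then have "F \<in> ucel_cells n w (n - length (shape F))
      \<and> G \<in> ucel_cells n w (Suc (n - length (shape F)))"
    using FG by (simp add: ucel_cells_iff)
  then show "case p of (F, G) \<Rightarrow> (\<exists>k. F \<in> ucel_cells n w k \<and> G \<in> ucel_cells n w (Suc k))
                  \<and> ucel_incidence G F \<noteq> 0"
    using FG(1) p matching_incidence(1) by auto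
next
  fix p q assume pq: "p \<in> matching n w" "q \<in> matching n w" "p \<noteq> q"
  have tgt: "tgt w (shape (fst p)) = Some (shape (snd p))"
      "src w (shape (snd p)) = Some (shape (fst p))"
     "word w (shape (fst p))" "word w (shape (snd p))"
    if "p \<in> matching n w" for p
    using that src_tgt shape_in_words[of _ n w] by (auto simp: matching_def words_def)
  have inj: "fst p = cell_of n w (shape (fst p))" "snd p = cell_of n w (shape (snd p))"
      if "p \<in> matching n w" for p
    using that cell_of_shape by (auto simp: matching_def)
  have "fst p \<noteq> fst q" "snd p \<noteq> snd q"
    using pq tgt inj by (metis option.inject prod_eqI)+
  moreover have "fst p \<noteq> snd q" if "p \<in> matching n w" "q \<in> matching n w" for p q
    using tgt[OF that(1)] tgt[OF that(2)] not_src_tgt by (metis option.distinct(1))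
  from this[of p q] this[of q p] calculation show "{fst p, snd p} \<inter> {fst q, snd q} = {}"
    using pq(1,2) by auto
qed

text \<open>Lower cells strictly increase along a walk, since each is the smallest face of its
  partner.\<close>

lemma no_closed_walk: "\<not> closed_walk (matching n w) ps"
proof
  assume ps: "closed_walk (matching n w) ps"
  then have len: "length ps \<ge> 2" and V: "\<And>i. i < length ps \<Longrightarrow> ps ! i \<in> matching n w"
    by (auto simp: closed_walk_def)
  have step: "cell_less w (fst (ps ! i)) (fst (ps ! Suc i))" if "Suc i < length ps" for i
  proof (rule matching_incidence(2)[of _ "snd (ps ! i)" n])
    show "(fst (ps ! i), snd (ps ! i)) \<in> matching n w"
      using V[of i] that by simp
    show "fst (ps ! Suc i) \<in> ucel n w"
      using V[of "Suc i"] that by (auto simp: matching_def)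
  qed (use ps that in \<open>auto simp: closed_walk_def\<close>)
  have "cell_less w (fst (ps ! 0)) (fst (ps ! Suc i))" if "Suc i < length ps" for i
    using that
  proof (induction i)
    case (Suc i)
    then have "cell_less w (fst (ps ! 0)) (fst (ps ! Suc i))"
      by simp
    then show ?case
      using step[OF Suc(2)] by (rule transpD[OF transp_cell_less])
  qed (use step in simp)
  \<comment> \<open>With this index \<open>Suc i\<close> is the last position.\<close>
  from this[of "length ps - 2"] have "cell_less w (fst (hd ps)) (fst (last ps))"
    using len by (simp add: hd_conv_nth last_conv_nth numeral_2_eq_2 Suc_diff_Suc
        flip: length_greater_0_conv)
  then show False
    using ps asympD[OF asymp_cell_less] by (metis closed_walk_def)
qed

lemma critical_cells_matching:
  "critical_cells n w (matching n w) = {F \<in> ucel n w. crit w (shape F)}"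
proof -
  have "(\<forall>p\<in>matching n w. F \<noteq> fst p \<and> F \<noteq> snd p) \<longleftrightarrow> crit w (shape F)"
    if F: "F \<in> ucel n w" for F
  proof -
    have sF: "shape F \<in> words n w"
      using F by (rule shape_in_words)
    have "\<exists>p\<in>matching n w. F = snd p" if f: "src w (shape F) = Some f" for f
    proof -
      have "(cell_of n w f, F) \<in> matching n w"
        using F f src_words[OF sF f] by (simp add: matching_def cell_of_in_ucel shape_cell_of)
      then show ?thesis by force
    qed
    moreover have "\<exists>p\<in>matching n w. F = fst p" if g: "tgt w (shape F) = Some g" for g
    proof -
      have "(F, cell_of n w g) \<in> matching n w"
        using F tgt_words[OF sF g] tgt_src[OF g wordsD(1)[OF sF]]
        by (simp add: matching_def cell_of_in_ucel shape_cell_of)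
      then show ?thesis by force
    qed
    moreover have "src w (shape F) \<noteq> None" if "p \<in> matching n w" "F = snd p" for p
      using that by (auto simp: matching_def)
    moreover have "tgt w (shape F) \<noteq> None" if "p \<in> matching n w" "F = fst p" for p
    proof -
      have "snd p \<in> ucel n w" "src w (shape (snd p)) = Some (shape F)"
        using that by (auto simp: matching_def)
      then show ?thesis
        using src_tgt word_shape by fastforce
    qed
    ultimately have "(\<forall>p\<in>matching n w. F \<noteq> fst p \<and> F \<noteq> snd p)
        \<longleftrightarrow> src w (shape F) = None \<and> tgt w (shape F) = None"
      by (metis not_None_eq)
    then show ?thesis
      using crit_iff[OF word_shape[OF F]] by simp
  qed
  then show ?thesis
    by (auto simp: critical_cells_def)
qed

section \<open>The adapted basis of the chains\<close>

definition cycle_chain :: "nat \<Rightarrow> nat \<Rightarrow> ucell \<Rightarrow> uchain" where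
  "cycle_chain n w F = (\<lambda>G. if G \<in> ucel n w then cycle_eval (delta (shape G)) (shape F) else 0)"

lemma ucel_bd_delta:
  assumes "F \<in> ucel n w"
  shows "ucel_bd n w (delta F) = (\<lambda>G. if G \<in> ucel n w then bd_eval (delta (shape G)) (shape F)
      else 0)"
proof
  fix H
  have "(\<Sum>G\<in>ucel n w. delta F G * of_int (ucel_incidence G H)) = of_int (ucel_incidence F H)"
    by (subst sum.remove[OF finite_ucel assms]) (auto intro!: sum.neutral)
  then show "ucel_bd n w (delta F) H = (if H \<in> ucel n w then bd_eval (delta (shape H)) (shape F)
      else 0)"
    using ucel_incidence_eq[of H n w F] assms unfolding ucel_bd_def by simp
qed

lemma ucel_bd_sum:
  "ucel_bd n w (\<lambda>G. \<Sum>F\<in>A. \<alpha> F * c F G) = (\<lambda>G. \<Sum>F\<in>A. \<alpha> F * ucel_bd n w (c F) G)"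
proof (induction A rule: infinite_finite_induct)
  case (insert F A)
  then show ?case
    by (simp add: ucel_bd_add ucel_bd_scale)
qed (simp_all add: ucel_bd_zero)

lemma ucel_bd_of_shape:
  "ucel_bd n w (\<lambda>G. if G \<in> ucel n w then h (shape G) else 0)
    = (\<lambda>H. if H \<in> ucel n w then \<Sum>g\<in>words n w. h g * bd_eval (delta (shape H)) g else 0)"
proof
  fix H
  have "(\<Sum>G\<in>ucel n w. h (shape G) * of_int (ucel_incidence G H))
      = (\<Sum>g\<in>words n w. h g * bd_eval (delta (shape H)) g)" if "H \<in> ucel n w"
    unfolding sum_ucel[symmetric] using that by (intro sum.cong) (auto simp: ucel_incidence_eq)
  then show "ucel_bd n w (\<lambda>G. if G \<in> ucel n w then h (shape G) else 0) H
    = (if H \<in> ucel n w then \<Sum>g\<in>words n w. h g * bd_eval (delta (shape H)) g else 0)"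
    by (simp add: ucel_bd_def)
qed

lemma ucel_bd_bd_delta:
  assumes "F \<in> ucel n w"
  shows "ucel_bd n w (ucel_bd n w (delta F)) = (\<lambda>_. 0)"
proof -
  have w: "shape F \<in> words n w"
    using assms by (rule shape_in_words)
  have "bd_eval (bd_eval \<phi>) (shape F) = 0" for \<phi>
    by (rule bd_eval_bd_eval) (use word_shape[OF assms] in auto)
  then show ?thesis
    unfolding ucel_bd_delta[OF assms] ucel_bd_of_shape[of n w "\<lambda>g. bd_eval (delta g) (shape F)"]
      bd_eval_expand[OF w, symmetric] by (simp cong: if_cong)
qed

text \<open>Expanding \<open>cycle_eval\<close> over words identifies each coefficient of the
  boundary with \<open>cycle_eval (bd_eval \<phi>)\<close> for some \<open>\<phi>\<close>, which is
  zero.\<close>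

lemma ucel_bd_cycle_chain:
  assumes "F \<in> ucel n w" "crit w (shape F)"
  shows "ucel_bd n w (cycle_chain n w F) = (\<lambda>_. 0)"
proof -
  have w: "shape F \<in> words n w"
    using assms by (intro shape_in_words)
  have "cycle_eval (bd_eval \<phi>) (shape F) = 0" for \<phi>
    by (rule cycle_eval_bd_eval[OF word_shape]) (use assms in auto)
  then show ?thesis
    unfolding cycle_chain_def ucel_bd_of_shape[of n w "\<lambda>g. cycle_eval (delta g) (shape F)"]
      cycle_eval_expand[OF w assms(2), symmetric] by (simp cong: if_cong)
qed

text \<open>The partner maps \<open>mate\<close> and \<open>low\<close> are total; their values are
  meaningful only where \<open>tgt\<close> and \<open>src\<close>, respectively, are
  defined.\<close>

definition mate :: "nat \<Rightarrow> nat \<Rightarrow> ucell \<Rightarrow> ucell" where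
  "mate n w F = cell_of n w (the (tgt w (shape F)))"

definition low :: "nat \<Rightarrow> nat \<Rightarrow> ucell \<Rightarrow> ucell" where
  "low n w G = cell_of n w (the (src w (shape G)))"

lemma mate_low:
  assumes "G \<in> ucel n w" "src w (shape G) \<noteq> None"
  shows "low n w G \<in> ucel n w" "src w (shape G) = Some (shape (low n w G))"
    "tgt w (shape (low n w G)) = Some (shape G)" "mate n w (low n w G) = G"
    "G \<in> ucel_cells n w (Suc k) \<longleftrightarrow> low n w G \<in> ucel_cells n w k"
proof -
  obtain f where f: "src w (shape G) = Some f"
    using assms by auto
  have w: "shape G \<in> words n w" "word w (shape G)"
    using shape_in_words[OF assms(1)] by (auto simp: words_def)
  have f': "f \<in> words n w"
    using src_words[OF w(1) f] .
  show 1: "low n w G \<in> ucel n w" "src w (shape G) = Some (shape (low n w G))"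
    using f f' by (auto simp: low_def cell_of_in_ucel shape_cell_of)
  then show 2: "tgt w (shape (low n w G)) = Some (shape G)"
    using w(2) by (intro src_tgt)
  then show "mate n w (low n w G) = G"
    using assms by (simp add: mate_def cell_of_shape)
  show "G \<in> ucel_cells n w (Suc k) \<longleftrightarrow> low n w G \<in> ucel_cells n w k"
    using assms 1(1) src_length[OF w(1) 1(2)] by (simp add: ucel_cells_iff)
qed

lemma low_mate:
  assumes "F \<in> ucel n w" "tgt w (shape F) \<noteq> None"
  shows "mate n w F \<in> ucel n w" "src w (shape (mate n w F)) = Some (shape F)"
      "low n w (mate n w F) = F"
proof -
  obtain g where g: "tgt w (shape F) = Some g"
    using assms by auto
  have w: "shape F \<in> words n w" "word w (shape F)"
    using shape_in_words[OF assms(1)] by (auto simp: words_def)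
  have g': "g \<in> words n w" "src w g = Some (shape F)"
    using tgt_words[OF w(1) g] tgt_src[OF g w(2)] by auto
  then show "mate n w F \<in> ucel n w" "src w (shape (mate n w F)) = Some (shape F)"
    using g by (auto simp: mate_def cell_of_in_ucel shape_cell_of)
  then show "low n w (mate n w F) = F"
    using assms by (simp add: low_def cell_of_shape)
qed

text \<open>A basis of the chains, triangular for \<open>cell_less\<close>.\<close>

definition adapted :: "nat \<Rightarrow> nat \<Rightarrow> ucell \<Rightarrow> uchain" where
  "adapted n w F = (if crit w (shape F) then cycle_chain n w F
     else if src w (shape F) = None then ucel_bd n w (delta (mate n w F)) else delta F)"

lemma cell_cases:
  assumes "F \<in> ucel n w"
  obtains (critical) "crit w (shape F)" "adapted n w F = cycle_chain n w F"
    | (source) "tgt w (shape F) \<noteq> None" "src w (shape F) = None" "\<not> crit w (shape F)"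
        "adapted n w F = ucel_bd n w (delta (mate n w F))"
    | (target) "src w (shape F) \<noteq> None" "tgt w (shape F) = None" "\<not> crit w (shape F)"
        "adapted n w F = delta F"
proof -
  consider "crit w (shape F)" | "\<not> crit w (shape F)" "src w (shape F) = None"
    | "\<not> crit w (shape F)" "src w (shape F) \<noteq> None"
    by blast
  then show thesis
  proof cases
    case 1
    then show ?thesis
      by (intro critical) (simp_all add: adapted_def)
  next
    case 2
    then have "tgt w (shape F) \<noteq> None"
      using crit_iff[OF word_shape[OF assms]] by simp
    with 2 show ?thesis
      by (intro source) (simp_all add: adapted_def)
  next
    case 3
    then obtain f where f: "src w (shape F) = Some f"
      by auto
    with 3 show ?thesis
      using not_src_tgt[OF word_shape[OF assms]] by (intro target) (simp_all add: adapted_def f)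
  qed
qed

lemma adapted_lead:
  assumes "F \<in> ucel n w"
  shows "adapted n w F F \<noteq> 0"
    and "adapted n w F G \<noteq> 0 \<Longrightarrow> F \<noteq> G \<Longrightarrow> cell_less w F G"
    and "adapted n w F G \<noteq> 0 \<Longrightarrow> G \<in> ucel n w \<and> length (shape G) = length (shape F)"
proof -
  have neq: "shape F \<noteq> shape G" if "F \<noteq> G" "G \<in> ucel n w" for G
    using that assms cell_of_shape by metis
  from assms have *: "adapted n w F F \<noteq> 0 \<and> (adapted n w F G \<noteq> 0 \<longrightarrow>
      G \<in> ucel n w \<and> length (shape G) = length (shape F) \<and> (F \<noteq> G \<longrightarrow> cell_less w F G))"
  proof (cases rule: cell_cases)
    case critical
    note c = word_shape[OF assms] critical(1)
    show ?thesis
      unfolding critical(2) cycle_chain_def cell_less_def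
      using assms cycle_eval_delta_lead(1)[OF c] cycle_eval_delta_lead(2)[OF c, of "shape G"]
        cycle_eval_delta_length[OF c, of "shape G"] neq[of G] by (simp split: if_splits) metis
  next
    case source
    note m = low_mate[OF assms source(1)]
    note c = word_shape[OF m(1)] m(2)
    have "length (shape F) = Suc (length (shape (mate n w F)))"
      using src_word[OF c(2,1)] by simp
    then show ?thesis
      unfolding source(4) ucel_bd_delta[OF m(1)] cell_less_def
      using assms bd_eval_delta_lead(1)[OF c] bd_eval_delta_lead(2)[OF c, of "shape G"]
        bd_eval_delta_length[OF c(1), of "shape G"] neq[of G] by (simp split: if_splits) metis
  next
    case target
    then show ?thesis
      using assms by simp
  qed
  then show "adapted n w F F \<noteq> 0"
    by blast
  show "cell_less w F G" if "adapted n w F G \<noteq> 0" "F \<noteq> G"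
    using * that by blast
  show "G \<in> ucel n w \<and> length (shape G) = length (shape F)" if "adapted n w F G \<noteq> 0"
    using * that by blast
qed

lemma adapted_chain:
  assumes "F \<in> ucel_cells n w k"
  shows "adapted n w F \<in> ucel_chains n w k"
  using assms adapted_lead(3)[of F n w] by (fastforce simp: ucel_chains_def ucel_cells_iff)

lemma adapted_span:
  assumes "x \<in> ucel_chains n w k"
  obtains \<alpha> where "x = (\<lambda>G. \<Sum>F\<in>ucel_cells n w k. \<alpha> F * adapted n w F G)"
proof -
  obtain \<alpha> where \<alpha>: "\<forall>G\<in>ucel_cells n w k. x G = (\<Sum>F\<in>ucel_cells n w k. \<alpha> F * adapted n w F G)"
    using triangular_span[of "ucel_cells n w k" "adapted n w"
      "cell_less w" x] adapted_lead[of _ n w]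
      finite_ucel_cells transp_cell_less asymp_cell_less by (auto simp: ucel_cells_iff)
  moreover have "x G = (\<Sum>F\<in>ucel_cells n w k. \<alpha> F * adapted n w F G)" if "G \<notin> ucel_cells n w k" for G
    using that assms adapted_chain[of _ n w k]
      by (auto simp: ucel_chains_def intro!: sum.neutral[symmetric])
  ultimately show thesis
    by (intro that[of \<alpha>] ext) blast
qed

lemma adapted_independent:
  assumes "(\<lambda>G. \<Sum>F\<in>A. \<alpha> F * adapted n w F G) = (\<lambda>_. 0)" "A \<subseteq> ucel n w" "F \<in> A"
  shows "\<alpha> F = 0"
proof (rule triangular_independent[of A "adapted n w" "cell_less w" \<alpha>])
  show "finite A"
    using assms finite_subset finite_ucel by blast
qed (use assms adapted_lead[of _ n w] transp_cell_less asymp_cell_less in \<open>auto dest: fun_cong\<close>)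

lemma adapted_cycle:
  assumes "F \<in> ucel n w" "src w (shape F) = None"
  shows "ucel_bd n w (adapted n w F) = (\<lambda>_. 0)"
  using assms(1)
proof (cases rule: cell_cases)
  case critical
  then show ?thesis
    using ucel_bd_cycle_chain[OF assms(1)] by simp
next
  case source
  then show ?thesis
    using ucel_bd_bd_delta[OF low_mate(1)[OF assms(1)]] by simp
qed (use assms in simp)

text \<open>In the adapted basis the boundary is a partial bijection of basis vectors: upper cells
  go to their partners, and by \<open>adapted_cycle\<close> all others go to zero.\<close>

lemma ucel_bd_target:
  assumes "G \<in> ucel n w" "src w (shape G) \<noteq> None"
  shows "ucel_bd n w (adapted n w G) = adapted n w (low n w G)"
proof -
  note l = mate_low[OF assms]
  have "adapted n w G = delta G"
    using assms(1) by (cases rule: cell_cases) (use assms crit_iff[OF word_shape[OF assms(1)]]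
      in auto)
  moreover have "adapted n w (low n w G) = ucel_bd n w (delta G)"
    using l(1) by (cases rule: cell_cases) (use l crit_iff[OF word_shape[OF l(1)]]
        not_src_tgt[OF word_shape[OF l(1)]] in auto)
  ultimately show ?thesis
    by simp
qed

section \<open>Cycles and boundaries in the adapted basis\<close>

definition sources :: "nat \<Rightarrow> nat \<Rightarrow> nat \<Rightarrow> ucell set" where
  "sources n w k = {F \<in> ucel_cells n w k. tgt w (shape F) \<noteq> None}"

definition targets :: "nat \<Rightarrow> nat \<Rightarrow> nat \<Rightarrow> ucell set" where
  "targets n w k = {F \<in> ucel_cells n w k. src w (shape F) \<noteq> None}"

definition criticals :: "nat \<Rightarrow> nat \<Rightarrow> nat \<Rightarrow> ucell set" where
  "criticals n w k = {F \<in> ucel_cells n w k. crit w (shape F)}"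

lemma finite_cell_classes: "finite (sources n w k)" "finite (targets n w k)"
    "finite (criticals n w k)"
  using finite_ucel_cells[of n w k] by (auto simp: sources_def targets_def criticals_def)

lemma ucel_cells_split:
  "ucel_cells n w k = targets n w k \<union> (sources n w k \<union> criticals n w k)"
  "targets n w k \<inter> (sources n w k \<union> criticals n w k) = {}"
  "sources n w k \<inter> criticals n w k = {}"
proof -
  have *: "crit w (shape F) \<longleftrightarrow> src w (shape F) = None \<and> tgt w (shape F) = None"
    "tgt w (shape F) \<noteq> None \<Longrightarrow> src w (shape F) = None" if "F \<in> ucel_cells n w k" for F
    using that crit_iff[OF word_shape[of F n w]] not_src_tgt[OF word_shape[of F n w]]
    by (auto simp: ucel_cells_iff)
  show "ucel_cells n w k = targets n w k \<union> (sources n w k \<union> criticals n w k)"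
    unfolding sources_def targets_def criticals_def by (auto simp: * simp del: not_None_eq)
  show "targets n w k \<inter> (sources n w k \<union> criticals n w k) = {}"
    unfolding sources_def targets_def criticals_def by (auto simp: * simp del: not_None_eq)
  show "sources n w k \<inter> criticals n w k = {}"
    unfolding sources_def targets_def criticals_def by (auto simp: * simp del: not_None_eq)
qed

lemma ucel_bd_adapted_sum:
  "ucel_bd n w (\<lambda>G. \<Sum>F\<in>ucel_cells n w k. \<alpha> F * adapted n w F G)
    = (\<lambda>G. \<Sum>F\<in>targets n w k. \<alpha> F * adapted n w (low n w F) G)"
proof
  fix G
  have "ucel_bd n w (\<lambda>G. \<Sum>F\<in>ucel_cells n w k. \<alpha> F * adapted n w F G) G
      = (\<Sum>F\<in>ucel_cells n w k. \<alpha> F * ucel_bd n w (adapted n w F) G)"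
    by (simp add: ucel_bd_sum)
  also have "\<dots> = (\<Sum>F\<in>targets n w k. \<alpha> F * ucel_bd n w (adapted n w F) G)"
    using adapted_cycle[of _ n w] finite_ucel_cells
    by (intro sum.mono_neutral_right) (auto simp: targets_def ucel_cells_iff)
  also have "\<dots> = (\<Sum>F\<in>targets n w k. \<alpha> F * adapted n w (low n w F) G)"
    by (intro sum.cong) (auto simp: targets_def ucel_cells_iff ucel_bd_target)
  finally show "ucel_bd n w (\<lambda>G. \<Sum>F\<in>ucel_cells n w k. \<alpha> F * adapted n w F G) G = \<dots>" .
qed

lemma sum_low:
  "(\<Sum>F\<in>targets n w (Suc k). \<alpha> F * adapted n w (low n w F) G)
    = (\<Sum>F\<in>sources n w k. \<alpha> (mate n w F) * adapted n w F G)"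
proof (rule sum.reindex_bij_witness[of _ "mate n w" "low n w"])
  fix F assume "F \<in> targets n w (Suc k)"
  then have F: "F \<in> ucel n w" "src w (shape F) \<noteq> None" "F \<in> ucel_cells n w (Suc k)"
    by (auto simp: targets_def ucel_cells_iff)
  show "mate n w (low n w F) = F" "low n w F \<in> sources n w k"
    "\<alpha> (mate n w (low n w F)) * adapted n w (low n w F) G = \<alpha> F * adapted n w (low n w F) G"
    using mate_low[OF F(1,2)] F(3) by (auto simp: sources_def)
next
  fix F assume "F \<in> sources n w k"
  then have F: "F \<in> ucel n w" "tgt w (shape F) \<noteq> None" "F \<in> ucel_cells n w k"
    by (auto simp: sources_def ucel_cells_iff)
  then show "low n w (mate n w F) = F" "mate n w F \<in> targets n w (Suc k)"
    using low_mate[OF F(1,2)] mate_low(5)[of "mate n w F" n w k] by (auto simp: targets_def)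
qed

lemma boundaries_eq:
  "ucel_boundaries n w k = {\<lambda>G. \<Sum>F\<in>sources n w k. \<alpha> F * adapted n w F G | \<alpha>. True}"
proof (intro subset_antisym subsetI)
  fix x assume "x \<in> ucel_boundaries n w k"
  then obtain y where y: "y \<in> ucel_chains n w (Suc k)" "x = ucel_bd n w y"
    by (auto simp: ucel_boundaries_def)
  obtain \<alpha> where "y = (\<lambda>G. \<Sum>F\<in>ucel_cells n w (Suc k). \<alpha> F * adapted n w F G)"
    using adapted_span[OF y(1)] .
  then have "x = (\<lambda>G. \<Sum>F\<in>sources n w k. \<alpha> (mate n w F) * adapted n w F G)"
    unfolding y(2) by (simp only: ucel_bd_adapted_sum sum_low)
  then show "x \<in> {\<lambda>G. \<Sum>F\<in>sources n w k. \<alpha> F * adapted n w F G | \<alpha>. True}"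
    by (intro CollectI exI[of _ "\<lambda>F. \<alpha> (mate n w F)"] conjI TrueI)
next
  fix x assume "x \<in> {\<lambda>G. \<Sum>F\<in>sources n w k. \<alpha> F * adapted n w F G | \<alpha>. True}"
  then obtain \<alpha> where x: "x = (\<lambda>G. \<Sum>F\<in>sources n w k. \<alpha> F * adapted n w F G)"
    by auto
  \<comment> \<open>Each coefficient is moved from a lower cell to its upper partner.\<close>
  define y where "y = (\<lambda>G. \<Sum>F\<in>ucel_cells n w (Suc k). \<alpha> (low n w F) * adapted n w F G)"
  have "ucel_bd n w y = (\<lambda>G. \<Sum>F\<in>sources n w k. \<alpha> (low n w (mate n w F)) * adapted n w F G)"
    unfolding y_def ucel_bd_adapted_sum sum_low[of "\<lambda>F. \<alpha> (low n w F)"] ..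
  also have "\<dots> = x"
    unfolding x by (intro ext sum.cong) (auto simp: sources_def ucel_cells_iff low_mate)
  finally have "x = ucel_bd n w y" ..
  moreover have "y \<in> ucel_chains n w (Suc k)"
    using adapted_chain[of _ n w "Suc k"] by (auto simp: y_def ucel_chains_def intro!: sum.neutral)
  ultimately show "x \<in> ucel_boundaries n w k"
    by (auto simp: ucel_boundaries_def)
qed

text \<open>The boundaries of the upper basis vectors are independent, so a cycle involves none of
  these vectors; its lower part is a boundary by \<open>boundaries_eq\<close>.\<close>

lemma cycle_decomposition:
  assumes "x \<in> ucel_cycles n w k"
  obtains \<alpha> b where "b \<in> ucel_boundaries n w k"
    "x = (\<lambda>G. (\<Sum>F\<in>criticals n w k. \<alpha> F * adapted n w F G) + b G)"
proof -
  have "x \<in> ucel_chains n w k" "ucel_bd n w x = (\<lambda>_. 0)"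
    using assms by (auto simp: ucel_cycles_def)
  then obtain \<alpha> where x: "x = (\<lambda>G. \<Sum>F\<in>ucel_cells n w k. \<alpha> F * adapted n w F G)"
    using adapted_span by blast
  have "(\<lambda>G. \<Sum>F\<in>targets n w k. \<alpha> F * adapted n w (low n w F) G) = (\<lambda>_. 0)"
    using \<open>ucel_bd n w x = (\<lambda>_. 0)\<close> unfolding x ucel_bd_adapted_sum .
  moreover have "(\<Sum>F\<in>targets n w k. \<alpha> F * adapted n w (low n w F) G)
      = (\<Sum>F\<in>low n w ` targets n w k. \<alpha> (mate n w F) * adapted n w F G)" for G
  proof (subst sum.reindex)
    show "inj_on (low n w) (targets n w k)"
      by (rule inj_on_inverseI[of _ "mate n w"]) (auto simp: targets_def ucel_cells_iff mate_low)
  qed (auto simp: targets_def ucel_cells_iff mate_low intro!: sum.cong)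
  ultimately have "(\<lambda>G. \<Sum>F\<in>low n w ` targets n w k. \<alpha> (mate n w F) * adapted n w F G) = (\<lambda>_. 0)"
    by simp
  then have "\<alpha> (mate n w F) = 0" if "F \<in> low n w ` targets n w k" for F
    using that mate_low(1) by (intro adapted_independent[of "\<lambda>F. \<alpha> (mate n w F)"])
      (auto simp: targets_def ucel_cells_iff)
  then have 0: "\<alpha> F = 0" if "F \<in> targets n w k" for F
    using that mate_low(4)[of F n w] by (force simp: targets_def ucel_cells_iff)
  show thesis
  proof (rule that[of "\<lambda>G. \<Sum>F\<in>sources n w k. \<alpha> F * adapted n w F G" \<alpha>])
    show "(\<lambda>G. \<Sum>F\<in>sources n w k. \<alpha> F * adapted n w F G) \<in> ucel_boundaries n w k"
      unfolding boundaries_eq by blast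
    show "x = (\<lambda>G. (\<Sum>F\<in>criticals n w k. \<alpha> F * adapted n w F G)
        + (\<Sum>F\<in>sources n w k. \<alpha> F * adapted n w F G))"
      unfolding x ucel_cells_split(1)
      by (simp add: sum.union_disjoint ucel_cells_split(2,3) finite_cell_classes 0 add.commute)
  qed
qed

text \<open>Boundaries are spanned by the basis vectors of lower cells, which are disjoint from the
  critical ones.\<close>

lemma critical_independent:
  assumes "(\<lambda>G. \<Sum>F\<in>criticals n w k. \<beta> F * adapted n w F G) \<in> ucel_boundaries n w k"
      "F \<in> criticals n w k"
  shows "\<beta> F = 0"
proof -
  obtain \<alpha> where \<alpha>: "(\<lambda>G. \<Sum>F\<in>criticals n w k. \<beta> F * adapted n w F G)
      = (\<lambda>G. \<Sum>F\<in>sources n w k. \<alpha> F * adapted n w F G)"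
    using assms unfolding boundaries_eq by blast
  let ?\<gamma> = "\<lambda>F. if F \<in> criticals n w k then \<beta> F else - \<alpha> F"
  have "(\<Sum>F\<in>sources n w k \<union> criticals n w k. ?\<gamma> F * adapted n w F G) = 0" for G
  proof -
    have "(\<Sum>F\<in>sources n w k. ?\<gamma> F * adapted n w F G) = - (\<Sum>F\<in>sources n w k. \<alpha> F * adapted n w F G)"
      unfolding sum_negf[symmetric] using ucel_cells_split(3)[of n w k] by (intro sum.cong) auto
    then show ?thesis
      using fun_cong[OF \<alpha>, of G]
      by (simp add: sum.union_disjoint ucel_cells_split(3) finite_cell_classes)
  qed
  then have "?\<gamma> F = 0"
    using assms(2) by (intro adapted_independent[where \<alpha> = ?\<gamma>
      and A = "sources n w k \<union> criticals n w k" and n = n and w = w])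
      (auto simp: sources_def criticals_def ucel_cells_iff)
  then show ?thesis
    using assms(2) by simp
qed

section \<open>Homology classes of the critical cycles\<close>

lemma homology_class_eqD:
  assumes "homology_class n w k u = homology_class n w k v"
  shows "(\<lambda>F. u F - v F) \<in> ucel_boundaries n w k"
proof -
  have "(\<lambda>F. u F + 0) \<in> homology_class n w k u"
    by (rule homology_classI[OF ucel_boundaries_zero])
  then obtain b where b: "b \<in> ucel_boundaries n w k" "u = (\<lambda>F. v F + b F)"
    unfolding assms by (auto simp: homology_class_def)
  then show ?thesis
    by simp
qed

text \<open>One inclusion suffices, applied to \<open>b\<close> and then to its negative.\<close>

lemma homology_class_boundary:
  assumes "b \<in> ucel_boundaries n w k"
  shows "homology_class n w k (\<lambda>F. u F + b F) = homology_class n w k u"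
proof -
  have sub: "homology_class n w k (\<lambda>F. u F + b F) \<subseteq> homology_class n w k u"
    if b: "b \<in> ucel_boundaries n w k" for u b
  proof
    fix x assume "x \<in> homology_class n w k (\<lambda>F. u F + b F)"
    then obtain c where c: "c \<in> ucel_boundaries n w k" "x = (\<lambda>F. u F + b F + c F)"
      by (auto simp: homology_class_def)
    then show "x \<in> homology_class n w k u"
      using homology_classI[OF ucel_boundaries_add[OF b c(1)], of u] by (simp add: add.assoc)
  qed
  have "(\<lambda>F. - 1 * b F) \<in> ucel_boundaries n w k"
    using assms by (rule ucel_boundaries_scale)
  from sub[OF assms, of u] sub[OF this, of "\<lambda>F. u F + b F"] show ?thesis
    by simp
qed

lemma adapted_in_cycles:
  assumes "F \<in> criticals n w k"
  shows "adapted n w F \<in> ucel_cycles n w k"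
proof -
  have F: "F \<in> ucel_cells n w k" "F \<in> ucel n w" "crit w (shape F)"
    using assms by (auto simp: criticals_def ucel_cells_iff)
  then have "src w (shape F) = None"
    using crit_iff[OF word_shape[OF F(2)]] by simp
  then show ?thesis
    using adapted_chain[OF F(1)] adapted_cycle[OF F(2)] by (simp add: ucel_cycles_def)
qed

text \<open>Translates linear combinations of cosets in the homology module into pointwise sums of
  chains.\<close>

lemma finsum_homology_class:
  assumes "finite A" "\<And>F. F \<in> A \<Longrightarrow> c F \<in> ucel_cycles n w k"
  shows "finsum (ucel_homology n w k) (\<lambda>F. \<beta> F \<odot>\<^bsub>ucel_homology n w k\<^esub> homology_class n w k (c F)) A
    = homology_class n w k (\<lambda>G. \<Sum>F\<in>A. \<beta> F * c F G)"
proof -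
  interpret H: vectorspace "class_ring :: rat ring" "ucel_homology n w k"
    by (rule vectorspace_ucel_homology)
  have smult: "\<beta> F \<odot>\<^bsub>ucel_homology n w k\<^esub> homology_class n w k u
      = homology_class n w k (\<lambda>G. \<beta> F * u G)" for F u
    by (simp add: ucel_homology_def homology_class_scale)
  have add: "homology_class n w k u \<oplus>\<^bsub>ucel_homology n w k\<^esub> homology_class n w k v
      = homology_class n w k (\<lambda>F. u F + v F)" for u v
    by (simp add: ucel_homology_def homology_class_add)
  have carrier: "homology_class n w k u \<in> carrier (ucel_homology n w k)"
      if "u \<in> ucel_cycles n w k" for u
    using that by (simp add: ucel_homology_def)
  have zero: "\<zero>\<^bsub>ucel_homology n w k\<^esub> = homology_class n w k (\<lambda>F. 0)"
    by (simp add: ucel_homology_def homology_class_zero)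
  show ?thesis
    unfolding smult using assms
  proof (induction A rule: finite_induct)
    case empty
    then show ?case
      by (simp only: H.finsum_empty zero sum.empty)
  next
    case (insert F A)
    have "finsum (ucel_homology n w k) (\<lambda>F. homology_class n w k (\<lambda>G. \<beta> F * c F G)) (insert F A)
      = homology_class n w k (\<lambda>G. \<beta> F * c F G)
        \<oplus>\<^bsub>ucel_homology n w k\<^esub> finsum (ucel_homology n w k) (\<lambda>F. homology_class n w k (\<lambda>G. \<beta> F * c
            F G)) A"
      using insert by (intro H.finsum_insert) (auto intro!: carrier ucel_cycles_scale)
    also have "\<dots> = homology_class n w k (\<lambda>G. \<Sum>F\<in>insert F A. \<beta> F * c F G)"
      using insert by (simp add: add)
    finally show ?case .
  qed
qed

lemma critical_basis:
  shows "vectorspace.basis (class_ring :: rat ring) (ucel_homology n w k)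
      ((\<lambda>F. homology_class n w k (adapted n w F)) ` criticals n w k)"
      (is "vectorspace.basis ?K ?H (?h ` ?C)")
    and "inj_on (\<lambda>F. homology_class n w k (adapted n w F)) (criticals n w k)"
proof -
  interpret H: vectorspace ?K ?H
    by (rule vectorspace_ucel_homology)
  show inj: "inj_on ?h ?C"
  proof (rule inj_onI, rule ccontr)
    fix F F' assume F: "F \<in> ?C" "F' \<in> ?C" "?h F = ?h F'" "F \<noteq> F'"
    \<comment> \<open>Equal classes would make the difference of two critical cycles a
      boundary.\<close>
    let ?\<beta> = "\<lambda>H. if H = F then 1 else if H = F' then - 1 else 0 :: rat"
    have "(\<Sum>H\<in>?C. ?\<beta> H * adapted n w H G) = adapted n w F G - adapted n w F' G" for G
    proof -
      have "(\<Sum>H\<in>?C. ?\<beta> H * adapted n w H G) = (\<Sum>H\<in>{F, F'}. ?\<beta> H * adapted n w H G)"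
        using F by (intro sum.mono_neutral_right finite_cell_classes) auto
      then show ?thesis
        using F(4) by simp
    qed
    then have "(\<lambda>G. \<Sum>H\<in>?C. ?\<beta> H * adapted n w H G) \<in> ucel_boundaries n w k"
      using homology_class_eqD[OF F(3)] by simp
    from critical_independent[OF this F(1)] show False
      by simp
  qed
  have fin: "finite (?h ` ?C)"
    using finite_cell_classes(3) by (rule finite_imageI)
  have sub: "?h ` ?C \<subseteq> carrier ?H"
    using adapted_in_cycles by (auto simp: ucel_homology_def)
  have scalars: "carrier ?K = UNIV" "\<zero>\<^bsub>?K\<^esub> = 0"
    by (simp_all add: class_ring_simps)
  have zero: "\<zero>\<^bsub>?H\<^esub> = homology_class n w k (\<lambda>F. 0)"
    by (simp add: ucel_homology_def homology_class_zero)
  have lincomb: "H.lincomb a (?h ` ?C) = homology_class n w k (\<lambda>G. \<Sum>F\<in>?C. a (?h F) * adapted n w F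
      G)" for a
  proof -
    have "H.lincomb a (?h ` ?C) = finsum ?H (\<lambda>F. a (?h F) \<odot>\<^bsub>?H\<^esub> ?h F) ?C"
      unfolding H.lincomb_def using sub scalars
      by (intro H.finsum_reindex[OF _ inj]) (auto intro!: H.smult_closed)
    then show ?thesis
      using finsum_homology_class[OF finite_cell_classes(3) adapted_in_cycles] by simp
  qed
  have "H.lin_indpt (?h ` ?C)"
  proof (rule H.finite_lin_indpt2[OF fin sub], rule ballI)
    fix a v assume a: "H.lincomb a (?h ` ?C) = \<zero>\<^bsub>?H\<^esub>" and "v \<in> ?h ` ?C"
    then obtain F where F: "F \<in> ?C" "v = ?h F"
      by blast
    have "(\<lambda>G. \<Sum>F\<in>?C. a (?h F) * adapted n w F G) \<in> ucel_boundaries n w k"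
      using homology_class_eqD[OF a[unfolded lincomb zero]] by simp
    from critical_independent[OF this F(1)] show "a v = \<zero>\<^bsub>?K\<^esub>"
      using F(2) scalars by simp
  qed
  moreover have "H.span (?h ` ?C) = carrier ?H"
  proof
    show "H.span (?h ` ?C) \<subseteq> carrier ?H"
      using sub by (rule H.span_is_subset2)
    show "carrier ?H \<subseteq> H.span (?h ` ?C)"
    proof
      fix X assume "X \<in> carrier ?H"
      then obtain x where x: "x \<in> ucel_cycles n w k" "X = homology_class n w k x"
        by (auto simp: ucel_homology_def)
      obtain \<alpha> b where b: "b \<in> ucel_boundaries n w k"
        and x': "x = (\<lambda>G. (\<Sum>F\<in>?C. \<alpha> F * adapted n w F G) + b G)"
        using cycle_decomposition[OF x(1)] .
      have "X = homology_class n w k (\<lambda>G. \<Sum>F\<in>?C. \<alpha> F * adapted n w F G)"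
        unfolding x(2) x' by (rule homology_class_boundary[OF b])
      \<comment> \<open>Coefficients in \<open>lincomb\<close> are indexed by classes; injectivity
        recovers the cell from its class.\<close>
      also have "(\<lambda>G. \<Sum>F\<in>?C. \<alpha> F * adapted n w F G)
          = (\<lambda>G. \<Sum>F\<in>?C. \<alpha> (inv_into ?C ?h (?h F)) * adapted n w F G)"
        using inv_into_f_f[OF inj] by (intro ext sum.cong) auto
      finally have "X = H.lincomb (\<lambda>Y. \<alpha> (inv_into ?C ?h Y)) (?h ` ?C)"
        unfolding lincomb .
      then show "X \<in> H.span (?h ` ?C)"
        unfolding H.finite_span[OF fin sub] using scalars by blast
    qed
  qed
  ultimately show "H.basis (?h ` ?C)"
    unfolding H.basis_def using sub by blast
qed

theorem theorem9p3:
  fixes n w :: nat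
  assumes "w \<ge> 2"
  shows "\<exists>V. discrete_gradient_vector_field n w V
    \<and> (\<forall>k. \<exists>X. vectorspace.basis (class_ring :: rat ring) (ucel_homology n w k) X
               \<and> (\<exists>\<phi>. bij_betw \<phi> (critical_cells n w V \<inter> ucel_cells n w k) X))
    \<and> (\<forall>s\<in>cel n w. symb_orbit n s \<in> critical_cells n w V
                      \<longleftrightarrow> map length s \<in> critical_weights w)"
proof (intro exI[of _ "matching n w"] conjI allI ballI)
  show "discrete_gradient_vector_field n w (matching n w)"
    using discrete_vector_field_matching no_closed_walk
    by (auto simp: discrete_gradient_vector_field_def)
next
  fix k
  \<comment> \<open>The required bijection sends a critical cell to the class of its cycle.\<close>
  have "critical_cells n w (matching n w) \<inter> ucel_cells n w k = criticals n w k"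
    by (auto simp: critical_cells_matching criticals_def ucel_cells_iff)
  then show "\<exists>X. vectorspace.basis (class_ring :: rat ring) (ucel_homology n w k) X
      \<and> (\<exists>\<phi>. bij_betw \<phi> (critical_cells n w (matching n w) \<inter> ucel_cells n w k) X)"
    using critical_basis[of n w k] by (metis inj_on_imp_bij_betw)
next
  fix s assume s: "s \<in> cel n w"
  have "symb_orbit n s \<in> ucel n w"
    using s by (simp add: ucel_def)
  moreover have "word w (map length s)"
    using s by (auto simp: cel_def)
  ultimately show "symb_orbit n s \<in> critical_cells n w (matching n w)
      \<longleftrightarrow> map length s \<in> critical_weights w"
    using crit_iff_critical_weights[OF assms] by (simp add: critical_cells_matching
      shape_symb_orbit[OF s])
qed

end
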